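(* Let $\mathcal H$ be a finite-dimensional complex Hilbert space and $\mathcal H_S\subset\mathcal H$ a proper nonzero subspace. For $x\in\mathbb R^N$ let $H(x)$ be Hermitian and $L_1(x),\dots,L_M(x)\in\mathcal B(\mathcal H)$, where (in a fixed basis) the real and imaginary parts of all matrix entries of $H(x)$ and $L_k(x)$ are polynomial functions of $x$. Consider the Lindblad dynamics $\dot\rho=-i[H(x),\rho]+\sum_{k=1}^M\mathcal D_{L_k(x)}(\rho)$. Assume $\mathcal H_S$ is invariant for this dynamics for every $x\in\mathbb R^N$. If there exists $\bar x\in\mathbb R^N$ for which $\mathcal H_S$ is globally asymptotically stable, then $\mathcal H_S$ is globally asymptotically stable for Lebesgue-almost every $x\in\mathbb R^N$.
   Context: $\mathcal D_L(\rho)=L\rho L^*-\tfrac12(L^*L\rho+\rho L^*L)$. $\mathcal S(\mathcal H)$ denotes the density matrices; $\Pi_0$ is the orthogonal projection onto $\mathcal H_S$ and $\mathbf d_0(\rho)=\|\rho-\Pi_0\rho\Pi_0\|$ (Hilbert–Schmidt norm). $\mathcal H_S$ is invariant if every solution with $\mathrm{Tr}(\Pi_0\rho(0))=1$ satisfies $\mathrm{Tr}(\Pi_0\rho(t))=1$ for all $t\ge0$; it is globally asymptotically stable (GAS) if it is invariant, stable, and $\lim_{t\to\infty}\mathbf d_0(\rho(t))=0$ for every initial state $\rho(0)\in\mathcal S(\mathcal H)$. *)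

theory Defs
  imports "HOL-Analysis.Analysis"
begin

text \<open>Operators on the finite-dimensional Hilbert space \<open>complex ^ 'n\<close> are represented
  as matrices \<open>complex ^ 'n ^ 'n\<close> in the standard basis.  The norm on this type is the
  Euclidean norm of all entries, i.e. the Hilbert--Schmidt norm.\<close>

type_synonym 'n cmat = "complex ^ 'n ^ 'n"

definition adj :: "'n::finite cmat \<Rightarrow> 'n cmat" where
  "adj A = (\<chi> i j. cnj (A $ j $ i))"

definition csmult :: "complex \<Rightarrow> 'n::finite cmat \<Rightarrow> 'n cmat" where
  "csmult c A = (\<chi> i j. c * A $ i $ j)"

definition mtrace :: "'n::finite cmat \<Rightarrow> complex" where
  "mtrace A = (\<Sum>i\<in>UNIV. A $ i $ i)"

definition cinner :: "complex ^ 'n::finite \<Rightarrow> complex ^ 'n \<Rightarrow> complex" where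
  "cinner v w = (\<Sum>i\<in>UNIV. cnj (v $ i) * w $ i)"

definition hermitian :: "'n::finite cmat \<Rightarrow> bool" where
  "hermitian A \<longleftrightarrow> adj A = A"

definition psd :: "'n::finite cmat \<Rightarrow> bool" where
  "psd A \<longleftrightarrow> hermitian A \<and> (\<forall>v. Im (cinner v (A *v v)) = 0 \<and> Re (cinner v (A *v v)) \<ge> 0)"

definition density :: "'n::finite cmat \<Rightarrow> bool" where
  "density \<rho> \<longleftrightarrow> psd \<rho> \<and> mtrace \<rho> = 1"

text \<open>Orthogonal projections (the subspace \<open>\<H>_S\<close> is given by its orthogonal projection \<open>\<Pi>_0\<close>).\<close>
definition orth_proj :: "'n::finite cmat \<Rightarrow> bool" where
  "orth_proj P \<longleftrightarrow> hermitian P \<and> P ** P = P"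

definition dissipator :: "'n::finite cmat \<Rightarrow> 'n cmat \<Rightarrow> 'n cmat" where
  "dissipator L \<rho> = L ** \<rho> ** adj L
     - csmult (1/2) (adj L ** L ** \<rho> + \<rho> ** adj L ** L)"

definition lindblad :: "'n::finite cmat \<Rightarrow> (nat \<Rightarrow> 'n cmat) \<Rightarrow> nat \<Rightarrow> 'n cmat \<Rightarrow> 'n cmat" where
  "lindblad H L M \<rho> = csmult (- \<i>) (H ** \<rho> - \<rho> ** H) + (\<Sum>k<M. dissipator (L k) \<rho>)"

definition is_solution :: "('n::finite cmat \<Rightarrow> 'n cmat) \<Rightarrow> (real \<Rightarrow> 'n cmat) \<Rightarrow> bool" where
  "is_solution G \<rho> \<longleftrightarrow> (\<forall>t\<ge>0. (\<rho> has_vector_derivative G (\<rho> t)) (at t within {0..}))"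

definition dist0 :: "'n::finite cmat \<Rightarrow> 'n cmat \<Rightarrow> real" where
  "dist0 P \<rho> = norm (\<rho> - P ** \<rho> ** P)"

definition invariant :: "'n::finite cmat \<Rightarrow> ('n cmat \<Rightarrow> 'n cmat) \<Rightarrow> bool" where
  "invariant P G \<longleftrightarrow> (\<forall>\<rho>. is_solution G \<rho> \<longrightarrow> density (\<rho> 0) \<longrightarrow> mtrace (P ** \<rho> 0) = 1 \<longrightarrow>
      (\<forall>t\<ge>0. mtrace (P ** \<rho> t) = 1))"

definition stable :: "'n::finite cmat \<Rightarrow> ('n cmat \<Rightarrow> 'n cmat) \<Rightarrow> bool" where
  "stable P G \<longleftrightarrow> (\<forall>\<epsilon>>0. \<exists>\<delta>>0. \<forall>\<rho>. is_solution G \<rho> \<longrightarrow> density (\<rho> 0) \<longrightarrow>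
      dist0 P (\<rho> 0) < \<delta> \<longrightarrow> (\<forall>t\<ge>0. dist0 P (\<rho> t) < \<epsilon>))"

definition GAS :: "'n::finite cmat \<Rightarrow> ('n cmat \<Rightarrow> 'n cmat) \<Rightarrow> bool" where
  "GAS P G \<longleftrightarrow> invariant P G \<and> stable P G \<and>
     (\<forall>\<rho>. is_solution G \<rho> \<longrightarrow> density (\<rho> 0) \<longrightarrow> ((\<lambda>t. dist0 P (\<rho> t)) \<longlongrightarrow> 0) at_top)"

inductive polyfun :: "(real ^ 'N \<Rightarrow> real) \<Rightarrow> bool" where
  const: "polyfun (\<lambda>x. c)"
| coord: "polyfun (\<lambda>x. x $ i)"
| add: "polyfun f \<Longrightarrow> polyfun g \<Longrightarrow> polyfun (\<lambda>x. f x + g x)"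
| mult: "polyfun f \<Longrightarrow> polyfun g \<Longrightarrow> polyfun (\<lambda>x. f x * g x)"

definition poly_matrix_fun :: "(real ^ 'N \<Rightarrow> 'n::finite cmat) \<Rightarrow> bool" where
  "poly_matrix_fun F \<longleftrightarrow> (\<forall>i j. polyfun (\<lambda>x. Re (F x $ i $ j)) \<and> polyfun (\<lambda>x. Im (F x $ i $ j)))"

end

theory Submission
  imports Defs "HOL-Computational_Algebra.Polynomial"
begin

text \<open>Write \<open>Q = 1 - \<Pi>\<^sub>0\<close> and let \<open>G\<close> be the generator. Invariance makes the block \<open>Q \<rho> Q\<close> evolve
  autonomously under the compression \<open>X \<mapsto> Q G(X) Q\<close>, and positivity makes \<open>q = tr (Q \<rho>)\<close> nonincreasing
  and comparable with the distance to the target. Global asymptotic stability is equivalent to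
  injectivity of the compression on the \<open>Q\<close>-block: an element of the kernel is a stationary block,
  and conversely an inverse of the compression gives a bounded function whose derivative is \<open>q\<close>,
  so that \<open>q(t) = O(1/t)\<close>. Injectivity is the nonvanishing of a determinant, which is polynomial in
  the parameter, and a polynomial that is nonzero at one point vanishes only on a null set.\<close>

section \<open>Matrix algebra\<close>

text \<open>Decay of the \<open>Q\<close>-block would normally be read off its spectrum, but a
  spectral gap is not a polynomial condition on the parameter. Invertibility is the nonvanishing of
  a polynomial, yet by itself it excludes only the eigenvalue 0; the monotonicity of
  \<open>q\<close> supplies the rest, so no spectral theory enters. In the converse direction the
  obstacle is that stability speaks of density matrices, whereas a kernel element need be neither
  positive nor Hermitian. It is split into Hermitian parts, and a Hermitian \<open>A\<close> is the
  difference of two positive matrices, \<open>A\<close> plus a multiple of the identity and that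
  multiple itself, both densities up to scaling.\<close>

lemma adj_nth [simp]: "adj A $ i $ j = cnj (A $ j $ i)"
  by (simp add: adj_def)

lemma csmult_nth [simp]: "csmult c A $ i $ j = c * A $ i $ j"
  by (simp add: csmult_def)

lemma adj_adj [simp]: "adj (adj A) = A"
  by (simp add: vec_eq_iff)

lemma adj_zero [simp]: "adj 0 = 0"
  by (simp add: vec_eq_iff)

lemma adj_add: "adj (A + B) = adj A + adj B"
  by (simp add: vec_eq_iff)

lemma adj_diff: "adj (A - B) = adj A - adj B"
  by (simp add: vec_eq_iff)

lemma adj_scaleR: "adj (r *\<^sub>R A) = r *\<^sub>R adj A"
  by (simp add: vec_eq_iff)

lemma adj_csmult: "adj (csmult c A) = csmult (cnj c) (adj A)"
  by (simp add: vec_eq_iff)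

lemma adj_mat_1 [simp]: "adj (mat 1) = mat 1"
  by (simp add: vec_eq_iff mat_def)

lemma adj_mult: "adj (A ** B) = adj B ** adj A"
  by (simp add: vec_eq_iff matrix_matrix_mult_def mult.commute)

lemma adj_sum: "adj (\<Sum>k\<in>I. A k) = (\<Sum>k\<in>I. adj (A k))"
  by (induction I rule: infinite_finite_induct) (simp_all add: adj_add)

lemma csmult_mult_left: "csmult c A ** B = csmult c (A ** B)"
  by (simp add: vec_eq_iff matrix_matrix_mult_def sum_distrib_left mult.assoc)

lemma csmult_mult_right: "A ** csmult c B = csmult c (A ** B)"
  by (simp add: vec_eq_iff matrix_matrix_mult_def sum_distrib_left mult.left_commute)

lemma csmult_add: "csmult c (A + B) = csmult c A + csmult c B"
  by (simp add: vec_eq_iff algebra_simps)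

lemma csmult_diff: "csmult c (A - B) = csmult c A - csmult c B"
  by (simp add: vec_eq_iff algebra_simps)

lemma csmult_sum: "csmult c (\<Sum>k\<in>I. A k) = (\<Sum>k\<in>I. csmult c (A k))"
  by (simp add: vec_eq_iff sum_component sum_distrib_left)

lemma csmult_zero [simp]: "csmult c 0 = 0"
  by (simp add: vec_eq_iff)

lemma matrix_mult_diff_left: "A ** (B - C) = A ** B - A ** (C :: 'n::finite cmat)"
  by (simp add: vec_eq_iff matrix_matrix_mult_def sum_subtractf algebra_simps)

lemma matrix_mult_diff_right: "(B - C) ** A = B ** A - (C :: 'n::finite cmat) ** A"
  by (simp add: vec_eq_iff matrix_matrix_mult_def sum_subtractf algebra_simps)

lemma matrix_add_rdistrib: "(B + C) ** A = B ** A + (C :: 'n::finite cmat) ** A"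
  by (simp add: vec_eq_iff matrix_matrix_mult_def sum.distrib algebra_simps)

lemma matrix_mult_scaleR_left: "(r *\<^sub>R A) ** B = r *\<^sub>R (A ** (B :: 'n::finite cmat))"
  by (simp add: vec_eq_iff matrix_matrix_mult_def scaleR_sum_right)

lemma matrix_mult_scaleR_right: "A ** (r *\<^sub>R B) = r *\<^sub>R (A ** (B :: 'n::finite cmat))"
  by (simp add: vec_eq_iff matrix_matrix_mult_def scaleR_sum_right)

lemma matrix_mult_zero [simp]: "A ** 0 = (0 :: 'n::finite cmat)" "0 ** A = (0 :: 'n cmat)"
  by (simp_all add: vec_eq_iff matrix_matrix_mult_def)

lemma matrix_mult_sum_left: "A ** (\<Sum>k\<in>I. B k) = (\<Sum>k\<in>I. A ** (B k :: 'n::finite cmat))"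
  by (induction I rule: infinite_finite_induct) (simp_all add: matrix_add_ldistrib)

lemma matrix_mult_sum_right: "(\<Sum>k\<in>I. B k) ** A = (\<Sum>k\<in>I. (B k :: 'n::finite cmat) ** A)"
  by (induction I rule: infinite_finite_induct) (simp_all add: matrix_add_rdistrib)

lemmas matrix_distribs = matrix_add_ldistrib matrix_add_rdistrib matrix_mult_diff_left
  matrix_mult_diff_right matrix_mult_sum_left matrix_mult_sum_right

lemma linear_sandwich: "linear (\<lambda>X. (A :: 'n::finite cmat) ** X ** (B :: 'n cmat))"
  by (rule linearI)
    (simp_all add: matrix_add_ldistrib matrix_add_rdistrib matrix_mult_scaleR_left
      matrix_mult_scaleR_right)

lemma linear_mult_left: "linear (\<lambda>X. (A :: 'n::finite cmat) ** (X :: 'n cmat))"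
  using linear_sandwich[of A "mat 1"] by simp

lemma linear_mult_right: "linear (\<lambda>X. (X :: 'n::finite cmat) ** (A :: 'n cmat))"
  using linear_sandwich[of "mat 1" A] by simp

lemma linear_mtrace: "linear mtrace"
  by (rule linearI) (simp_all add: mtrace_def sum.distrib scaleR_sum_right)

lemmas mtrace_add = linear_add[OF linear_mtrace]
lemmas mtrace_diff = linear_diff[OF linear_mtrace]
lemmas mtrace_sum = linear_sum[OF linear_mtrace]
lemmas mtrace_zero = linear_0[OF linear_mtrace]
lemmas mtrace_scaleR = linear_scale[OF linear_mtrace]

lemma mtrace_mult_commute: "mtrace (A ** B) = mtrace (B ** A)"
  unfolding mtrace_def matrix_matrix_mult_def
  by (simp, subst sum.swap, simp add: mult.commute)

lemma norm_cmat_power2: "(norm (A :: 'n::finite cmat))\<^sup>2 = (\<Sum>i\<in>UNIV. \<Sum>j\<in>UNIV. (cmod (A $ i $ j))\<^sup>2)"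
  by (simp add: norm_vec_def L2_set_def sum_nonneg)

text \<open>Lets a vanishing trace of \<open>A ** adj A\<close> be read as
  \<open>A = 0\<close>.\<close>

lemma mtrace_mult_adj: "mtrace (A ** adj A) = of_real ((norm A)\<^sup>2)"
  by (simp add: norm_cmat_power2 mtrace_def matrix_matrix_mult_def complex_norm_square
      del: of_real_power)

section \<open>Positive semidefinite matrices\<close>

text \<open>The real part of the complex inner product is the real inner product of the library, and the
  imaginary part of a Hermitian form vanishes, so positivity can be handled with real inner
  products only.\<close>

lemma Re_cinner: "Re (cinner v w) = v \<bullet> w"
  by (simp add: cinner_def inner_vec_def inner_complex_def)

lemma cinner_mult_vector: "cinner v (A *v w) = cinner (adj A *v v) w"
  unfolding cinner_def matrix_vector_mult_def
  by (simp add: sum_distrib_left sum_distrib_right, subst sum.swap, simp add: ac_simps)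

lemma cinner_commute: "cinner v w = cnj (cinner w v)"
  by (simp add: cinner_def mult.commute)

lemma inner_mult_vector: "v \<bullet> (A *v w) = (adj A *v v) \<bullet> (w :: complex ^ 'n::finite)"
  using cinner_mult_vector[of v A w] by (metis Re_cinner)

lemma psd_iff: "psd A \<longleftrightarrow> hermitian A \<and> (\<forall>v. 0 \<le> v \<bullet> (A *v v))"
proof -
  have "Im (cinner v (A *v v)) = 0" if "hermitian A" for v
  proof -
    have "cinner v (A *v v) = cnj (cinner v (A *v v))"
      using that cinner_mult_vector[of v A v] cinner_commute[of "A *v v" v]
      by (simp add: hermitian_def)
    then show ?thesis
      by (metis Reals_cnj_iff complex_is_Real_iff)
  qed
  then show ?thesis
    by (auto simp: psd_def Re_cinner)
qed

lemma scaleR_mult_vector: "(r *\<^sub>R A) *v v = r *\<^sub>R (A *v (v :: complex ^ 'n::finite))"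
  by (simp add: vec_eq_iff matrix_vector_mult_def scaleR_sum_right)

lemma psd_scaleR: "psd A \<Longrightarrow> 0 \<le> r \<Longrightarrow> psd (r *\<^sub>R A)"
  by (simp add: psd_iff hermitian_def adj_scaleR scaleR_mult_vector)

lemma psd_sandwich: "psd X \<Longrightarrow> psd (A ** X ** adj A)"
  using inner_mult_vector[where A = A]
  by (simp add: psd_iff hermitian_def adj_mult matrix_mul_assoc
      flip: matrix_vector_mul_assoc)

lemma psd_mat_1: "psd (mat 1)"
  by (simp add: psd_iff hermitian_def)

lemma mult_axis_nth: "(A *v axis j 1) $ i = (A :: 'n::finite cmat) $ i $ j"
  by (simp add: matrix_vector_mult_def axis_def if_distrib cong: if_cong)

lemma cinner_axis: "cinner (axis i 1) v = v $ i"
  by (simp add: cinner_def axis_def if_distrib if_distribR cong: if_cong)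

lemma cmat_nth_eq_cinner: "(A :: 'n::finite cmat) $ i $ j = cinner (axis i 1) (A *v axis j 1)"
  by (simp add: cinner_axis mult_axis_nth)

lemma Re_mtrace: "Re (mtrace A) = (\<Sum>i\<in>UNIV. axis i 1 \<bullet> (A *v axis i 1))"
  by (simp add: mtrace_def cmat_nth_eq_cinner Re_cinner)

lemma psd_mtrace_nonneg: "psd A \<Longrightarrow> 0 \<le> Re (mtrace A)"
  by (simp add: Re_mtrace psd_iff sum_nonneg)

lemma hermitian_mtrace_real: "hermitian A \<Longrightarrow> Im (mtrace A) = 0"
proof -
  assume "hermitian A"
  then have "A $ i $ i = cnj (A $ i $ i)" for i
    by (metis hermitian_def adj_nth)
  then have "Im (A $ i $ i) = 0" for i
    by (metis Reals_cnj_iff complex_is_Real_iff)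
  then show ?thesis
    by (simp add: mtrace_def)
qed

section \<open>Cauchy-Schwarz estimates for positive forms\<close>

lemma hermitian_inner_commute:
  "hermitian X \<Longrightarrow> v \<bullet> (X *v w) = w \<bullet> (X *v (v :: complex ^ 'n::finite))"
  using inner_mult_vector[of v X w] by (simp add: hermitian_def inner_commute)

lemma psd_Cauchy_Schwarz:
  fixes X :: "'n::finite cmat"
  assumes "psd X"
  shows "(v \<bullet> (X *v w))\<^sup>2 \<le> (v \<bullet> (X *v v)) * (w \<bullet> (X *v w))"
proof -
  have expand: "(v + s *\<^sub>R w) \<bullet> (X *v (v + s *\<^sub>R w))
      = v \<bullet> (X *v v) + 2 * s * (v \<bullet> (X *v w)) + s\<^sup>2 * (w \<bullet> (X *v w))" for s
    using assms hermitian_inner_commute[of X w v] linear_scale[of "(*v) X" s w]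
    by (simp add: psd_iff algebra_simps inner_add_left inner_add_right power2_eq_square)
  have "0 \<le> v \<bullet> (X *v v) + 2 * s * (v \<bullet> (X *v w)) + s\<^sup>2 * (w \<bullet> (X *v w))" for s
    unfolding expand[symmetric] using assms by (simp add: psd_iff)
  note nonneg = this
  show ?thesis
  proof (cases "w \<bullet> (X *v w) = 0")
    case True
    have "v \<bullet> (X *v w) = 0"
    proof (rule ccontr)
      assume "v \<bullet> (X *v w) \<noteq> 0"
      \<comment> \<open>The polynomial in \<open>s\<close> is now affine, and this \<open>s\<close>
        gives it the value -1.\<close>
      then show False
        using nonneg[of "- (v \<bullet> (X *v v) + 1) / (2 * (v \<bullet> (X *v w)))"] True
        by (simp add: field_simps)
    qed
    then show ?thesis
      using True by simp
  next
    case False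
    moreover have "0 \<le> w \<bullet> (X *v w)"
      using assms by (simp add: psd_iff)
    ultimately have "0 < w \<bullet> (X *v w)"
      by simp
    \<comment> \<open>This \<open>s\<close> is the minimiser of the quadratic polynomial.\<close>
    then show ?thesis
      using nonneg[of "- (v \<bullet> (X *v w)) / (w \<bullet> (X *v w))"]
      by (simp add: field_simps power2_eq_square)
  qed
qed

text \<open>The real inner product sees only the real part; rotating \<open>v\<close> by
  \<open>\<i>\<close> exposes the imaginary part without changing the form at \<open>v\<close>. Each
  part satisfies the real Cauchy-Schwarz inequality, hence the factor 2, which is not sharp but
  suffices.\<close>

lemma psd_cinner_bound:
  assumes "psd X"
  shows "(cmod (cinner v (X *v w)))\<^sup>2 \<le> 2 * (v \<bullet> (X *v v)) * (w \<bullet> (X *v w))"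
proof -
  let ?u = "\<i> *s v"
  have Im: "Im (cinner v (X *v w)) = ?u \<bullet> (X *v w)"
    by (simp add: cinner_def inner_vec_def inner_complex_def algebra_simps)
  have "cnj (\<i> * z) * (\<i> * z') = cnj z * z'" for z z'
    by (simp add: complex_eq_iff)
  then have "cinner ?u (X *v ?u) = cinner v (X *v v)"
    by (simp only: cinner_def vector_scalar_commute vector_smult_component)
  then have u: "?u \<bullet> (X *v ?u) = v \<bullet> (X *v v)"
    by (metis Re_cinner)
  have "(cmod (cinner v (X *v w)))\<^sup>2 = (v \<bullet> (X *v w))\<^sup>2 + (?u \<bullet> (X *v w))\<^sup>2"
    by (simp add: cmod_power2 Re_cinner Im)
  also have "\<dots> \<le> 2 * (v \<bullet> (X *v v)) * (w \<bullet> (X *v w))"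
    using psd_Cauchy_Schwarz[OF assms, of v w] psd_Cauchy_Schwarz[OF assms, of ?u w] u by simp
  finally show ?thesis .
qed

text \<open>Every entry of the product is a value of the form of \<open>X\<close> at transformed
  basis vectors, so the entrywise bounds sum to a product of two traces. Taking \<open>A\<close> and
  \<open>B\<close> among \<open>P\<close>, \<open>Q\<close> and the identity controls each block of
  \<open>X\<close> by its diagonal blocks.\<close>

lemma psd_sandwich_norm_bound:
  assumes "psd X"
  shows "(norm (A ** X ** adj B))\<^sup>2 \<le> 2 * Re (mtrace (A ** X ** adj A)) * Re (mtrace (B ** X ** adj B))"
proof -
  define a where "a = (\<lambda>i. adj A *v axis i 1)"
  define b where "b = (\<lambda>i. adj B *v axis i 1)"
  have entry: "(A ** X ** adj B) $ i $ j = cinner (a i) (X *v b j)" for i j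
    by (simp add: cmat_nth_eq_cinner a_def b_def cinner_mult_vector[symmetric]
        flip: matrix_vector_mul_assoc)
  have trA: "Re (mtrace (A ** X ** adj A)) = (\<Sum>i\<in>UNIV. a i \<bullet> (X *v a i))"
    by (simp add: Re_mtrace a_def inner_mult_vector[where A = A] flip: matrix_vector_mul_assoc)
  have trB: "Re (mtrace (B ** X ** adj B)) = (\<Sum>i\<in>UNIV. b i \<bullet> (X *v b i))"
    by (simp add: Re_mtrace b_def inner_mult_vector[where A = B] flip: matrix_vector_mul_assoc)
  have "(norm (A ** X ** adj B))\<^sup>2
      \<le> (\<Sum>i\<in>UNIV. \<Sum>j\<in>UNIV. 2 * (a i \<bullet> (X *v a i)) * (b j \<bullet> (X *v b j)))"
    unfolding norm_cmat_power2 entry by (intro sum_mono psd_cinner_bound assms)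
  also have "\<dots> = 2 * Re (mtrace (A ** X ** adj A)) * Re (mtrace (B ** X ** adj B))"
    unfolding trA trB mult.assoc sum_product by (simp add: sum_distrib_left)
  finally show ?thesis .
qed

lemma psd_norm_le: "psd X \<Longrightarrow> (norm X)\<^sup>2 \<le> 2 * (Re (mtrace X))\<^sup>2"
  using psd_sandwich_norm_bound[of X "mat 1" "mat 1"] by (simp add: power2_eq_square)

text \<open>The shift is twice an operator bound of \<open>A\<close>: one copy compensates
  \<open>A\<close>, the other keeps the form strictly positive, so that the trace is positive and
  the matrix can be normalised to a density.\<close>

lemma hermitian_shift_psd:
  fixes A :: "'n::finite cmat"
  assumes "hermitian A"
  obtains c where "0 < c" "psd (c *\<^sub>R mat 1 + A)" "0 < Re (mtrace (c *\<^sub>R mat 1 + A))"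
proof -
  obtain B where B: "0 < B" "\<And>v. norm (A *v v) \<le> norm v * B"
    using bounded_linear.pos_bounded[OF matrix_vector_mul_bounded_linear[of A]] by blast
  have lower: "B * (norm v)\<^sup>2 \<le> v \<bullet> (((2 * B) *\<^sub>R mat 1 + A) *v v)" for v
  proof -
    have "\<bar>v \<bullet> (A *v v)\<bar> \<le> norm v * (norm v * B)"
      by (rule order_trans[OF Cauchy_Schwarz_ineq2 mult_left_mono[OF B(2)]]) simp
    then show ?thesis
      by (simp add: matrix_vector_mult_add_rdistrib scaleR_mult_vector inner_add_right
          power2_norm_eq_inner[symmetric] power2_eq_square algebra_simps)
  qed
  show ?thesis
  proof
    show "0 < 2 * B"
      using B by simp
    have "0 \<le> v \<bullet> (((2 * B) *\<^sub>R mat 1 + A) *v v)" for v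
      by (rule order_trans[OF _ lower]) (use B in simp)
    then show "psd ((2 * B) *\<^sub>R mat 1 + A)"
      using assms by (simp add: psd_iff hermitian_def adj_add adj_scaleR)
    have "0 < axis i 1 \<bullet> (((2 * B) *\<^sub>R mat 1 + A) *v axis i 1)" for i
      using lower[of "axis i 1"] B by (simp add: norm_axis_1)
    then show "0 < Re (mtrace ((2 * B) *\<^sub>R mat 1 + A))"
      unfolding Re_mtrace by (intro sum_pos) auto
  qed
qed

section \<open>Linear differential equations\<close>

lemma is_solutionD: "is_solution G y \<Longrightarrow> 0 \<le> t \<Longrightarrow> (y has_vector_derivative G (y t)) (at t within {0..})"
  by (simp add: is_solution_def)

lemma has_vector_derivative_nonneg_at:
  "(f has_vector_derivative D) (at t within {0..}) \<Longrightarrow> 0 < t \<Longrightarrow> (f has_vector_derivative D) (at t)"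
  for t :: real
  by (metis at_within_interior interior_real_atLeast greaterThan_iff)

text \<open>Solutions have only a one-sided derivative at 0, so the sign condition is imposed on the
  open interval and continuity takes care of the endpoints.\<close>

lemma nonneg_line_antimono:
  fixes f :: "real \<Rightarrow> real"
  assumes der: "\<And>t. 0 \<le> t \<Longrightarrow> (f has_vector_derivative f' t) (at t within {0..})"
    and le: "\<And>x. s < x \<Longrightarrow> x < t \<Longrightarrow> f' x \<le> 0" and "0 \<le> s" "s \<le> t"
  shows "f t \<le> f s"
proof (rule DERIV_nonpos_imp_decreasing_open[OF \<open>s \<le> t\<close>])
  fix x assume "s < x" "x < t"
  then show "\<exists>y. DERIV f x :> y \<and> y \<le> 0"
    using has_vector_derivative_nonneg_at[OF der[of x]] le[of x] \<open>0 \<le> s\<close>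
    by (auto simp: has_real_derivative_iff_has_vector_derivative)
next
  have "continuous_on {0..} f"
    using der by (intro continuous_on_vector_derivative[where f' = f']) auto
  then show "continuous_on {s..t} f"
    by (rule continuous_on_subset) (use \<open>0 \<le> s\<close> in auto)
qed

text \<open>A Gronwall argument: the weight \<open>exp (- (2 * B * t))\<close> makes the squared
  norm nonincreasing. By linearity this is uniqueness of solutions.\<close>

lemma linear_ode_zero:
  fixes y :: "real \<Rightarrow> 'a::euclidean_space"
  assumes G: "linear G"
    and y: "\<And>t. 0 \<le> t \<Longrightarrow> (y has_vector_derivative G (y t)) (at t within {0..})"
    and y0: "y 0 = 0" and t: "0 \<le> t"
  shows "y t = 0"
proof -
  obtain B where B: "0 < B" "\<And>v. norm (G v) \<le> norm v * B"
    using bounded_linear.pos_bounded[of G] G by (auto simp: linear_conv_bounded_linear)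
  define f where "f = (\<lambda>t. exp (- (2 * B * t)) * (y t \<bullet> y t))"
  define f' where "f' = (\<lambda>t. exp (- (2 * B * t)) * (2 * (y t \<bullet> G (y t)) - 2 * B * (y t \<bullet> y t)))"
  have "f t \<le> f 0"
  proof (rule nonneg_line_antimono[where f = f and f' = f'])
    fix s :: real assume s: "0 \<le> s"
    have "((\<lambda>t. y t \<bullet> y t) has_vector_derivative 2 * (y s \<bullet> G (y s))) (at s within {0..})"
      using has_derivative_inner[OF y[OF s, unfolded has_vector_derivative_def]
          y[OF s, unfolded has_vector_derivative_def]]
      by (simp add: has_vector_derivative_def inner_commute algebra_simps)
    then have "((\<lambda>t. y t \<bullet> y t) has_real_derivative 2 * (y s \<bullet> G (y s))) (at s within {0..})"
      by (simp add: has_real_derivative_iff_has_vector_derivative)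
    then have "(f has_real_derivative f' s) (at s within {0..})"
      unfolding f_def f'_def by (auto intro!: derivative_eq_intros simp: algebra_simps)
    then show "(f has_vector_derivative f' s) (at s within {0..})"
      by (simp add: has_real_derivative_iff_has_vector_derivative)
  next
    fix s :: real
    have "y s \<bullet> G (y s) \<le> norm (y s) * (norm (y s) * B)"
      by (rule order_trans[OF norm_cauchy_schwarz mult_left_mono[OF B(2)]]) simp
    then have "2 * (y s \<bullet> G (y s)) - 2 * B * (y s \<bullet> y s) \<le> 0"
      by (simp add: power2_norm_eq_inner[symmetric] power2_eq_square algebra_simps)
    then show "f' s \<le> 0"
      unfolding f'_def by (simp add: mult_le_0_iff)
  qed (use t in auto)
  moreover have "f 0 = 0"
    by (simp add: f_def y0)
  ultimately show ?thesis
    by (simp add: f_def mult_le_0_iff) (metis inner_gt_zero_iff not_less)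
qed

text \<open>The solution is the exponential series of \<open>G\<close> applied to \<open>X\<close>,
  differentiated termwise in each real coordinate. Existence matters because invariance and
  stability quantify over given solutions and yield information only once a solution is at
  hand.\<close>

lemma linear_ode_exists:
  fixes G :: "'a::euclidean_space \<Rightarrow> 'a"
  assumes G: "linear G"
  obtains y where "y 0 = X" "\<And>t. (y has_vector_derivative G (y t)) (at t)"
proof -
  obtain B where B: "0 < B" "\<And>v. norm (G v) \<le> norm v * B"
    using bounded_linear.pos_bounded[of G] G by (auto simp: linear_conv_bounded_linear)
  define a where "a = (\<lambda>n. (G ^^ n) X /\<^sub>R fact n)"
  have Ga: "G (a n) = real (Suc n) *\<^sub>R a (Suc n)" for n
    by (simp add: a_def linear_scale[OF G] del: of_nat_Suc)
  have bound: "norm ((G ^^ n) X) \<le> norm X * B ^ n" for n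
  proof (induction n)
    case (Suc n)
    have "norm ((G ^^ Suc n) X) \<le> norm ((G ^^ n) X) * B"
      using B by simp
    also have "\<dots> \<le> norm X * B ^ n * B"
      using Suc B by (intro mult_right_mono) auto
    finally show ?case
      by (simp add: mult_ac)
  qed simp
  have summable: "summable (\<lambda>n. t ^ n *\<^sub>R a n)" for t :: real
  proof (rule summable_comparison_test)
    have "norm (t ^ n *\<^sub>R a n) \<le> norm X * (inverse (fact n) * (\<bar>t\<bar> * B) ^ n)" for n
    proof -
      have "norm (t ^ n *\<^sub>R a n) = \<bar>t\<bar> ^ n * inverse (fact n) * norm ((G ^^ n) X)"
        by (simp add: a_def power_abs abs_mult)
      also have "\<dots> \<le> \<bar>t\<bar> ^ n * inverse (fact n) * (norm X * B ^ n)"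
        by (intro mult_left_mono bound) auto
      finally show ?thesis
        by (simp add: power_mult_distrib mult_ac)
    qed
    then show "\<exists>N. \<forall>n\<ge>N. norm (t ^ n *\<^sub>R a n) \<le> norm X * (inverse (fact n) * (\<bar>t\<bar> * B) ^ n)"
      by blast
    show "summable (\<lambda>n. norm X * (inverse (fact n) * (\<bar>t\<bar> * B) ^ n))"
      using summable_exp_generic[of "\<bar>t\<bar> * B"] by (intro summable_mult) (simp add: mult.commute)
  qed
  define y where "y = (\<lambda>t. \<Sum>n. t ^ n *\<^sub>R a n)"
  have inner: "y t \<bullet> b = (\<Sum>n. (a n \<bullet> b) * t ^ n)" for t b
    unfolding y_def
    using bounded_linear.suminf[OF bounded_linear_inner_left summable[of t], of b]
    by (simp add: mult.commute)
  have summable': "summable (\<lambda>n. (a n \<bullet> b) * t ^ n)" for t b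
    using bounded_linear.summable[OF bounded_linear_inner_left summable[of t], of b]
    by (simp add: mult.commute)
  have "(y has_vector_derivative G (y t)) (at t)" for t
  proof -
    have "((\<lambda>s. y s \<bullet> b) has_vector_derivative G (y t) \<bullet> b) (at t)" for b
    proof -
      have "G (y t) \<bullet> b = (\<Sum>n. G (t ^ n *\<^sub>R a n) \<bullet> b)"
        unfolding y_def
        using bounded_linear.suminf[OF bounded_linear_compose[OF bounded_linear_inner_left
            linear_conv_bounded_linear[THEN iffD1, OF G]] summable[of t], of b]
        by simp
      also have "\<dots> = (\<Sum>n. diffs (\<lambda>n. a n \<bullet> b) n * t ^ n)"
        by (simp add: linear_scale[OF G] Ga diffs_def algebra_simps)
      finally show ?thesis
        unfolding inner has_real_derivative_iff_has_vector_derivative[symmetric]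
        using termdiffs_strong_converges_everywhere[OF summable', of b t] by simp
    qed
    then show ?thesis
      unfolding has_vector_derivative_def
      by (subst has_derivative_componentwise_within) simp
  qed
  moreover have "y 0 = X"
    using suminf_finite[of "{0}" "\<lambda>n. 0 ^ n *\<^sub>R a n"] by (simp add: y_def a_def)
  ultimately show ?thesis
    using that by blast
qed

section \<open>Lindblad generators\<close>

lemma sum_mult_vector: "(\<Sum>k\<in>I. A k) *v v = (\<Sum>k\<in>I. (A k :: 'n::finite cmat) *v v)"
  by (induction I rule: infinite_finite_induct) (simp_all add: matrix_vector_mult_add_rdistrib)

text \<open>By homogeneity; restricting to the unit sphere makes compactness available in the
  positivity argument.\<close>

lemma psd_of_unit_vectors:
  assumes "hermitian A" "\<And>v. norm v = 1 \<Longrightarrow> 0 \<le> v \<bullet> (A *v v)"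
  shows "psd A"
proof -
  have "0 \<le> w \<bullet> (A *v w)" for w
  proof (cases "w = 0")
    case False
    define u where "u = w /\<^sub>R norm w"
    have u: "norm u = 1" and w: "w = norm w *\<^sub>R u"
      using False by (auto simp: u_def)
    have "A *v w = norm w *\<^sub>R (A *v u)"
      using linear_scale[OF bounded_linear.linear[OF matrix_vector_mul_bounded_linear]] w by metis
    then have "w \<bullet> (A *v w) = norm w * (norm w * (u \<bullet> (A *v u)))"
      using w by (metis inner_scaleR_left inner_scaleR_right)
    then show ?thesis
      using assms(2)[OF u] by simp
  qed simp
  then show ?thesis
    using assms(1) by (simp add: psd_iff)
qed

text \<open>Chosen so that the Lindblad generator takes the form
  \<open>K X + X K\<^sup>* + \<Sum>\<^sub>k L\<^sub>k X L\<^sub>k\<^sup>*\<close>.\<close>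

definition drift :: "'n::finite cmat \<Rightarrow> (nat \<Rightarrow> 'n cmat) \<Rightarrow> nat \<Rightarrow> 'n cmat" where
  "drift H L M = csmult (- \<i>) H - csmult (1/2) (\<Sum>k<M. adj (L k) ** L k)"

text \<open>\<open>balance\<close> says that the dual generator annihilates the identity, which is
  trace preservation. The Hamiltonian is absorbed into \<open>K\<close>.\<close>

locale gksl =
  fixes K :: "'n::finite cmat" and L :: "nat \<Rightarrow> 'n cmat" and M :: nat
  assumes balance: "K + adj K + (\<Sum>k<M. adj (L k) ** L k) = 0"
begin

definition G :: "'n cmat \<Rightarrow> 'n cmat" where
  "G X = K ** X + X ** adj K + (\<Sum>k<M. L k ** X ** adj (L k))"

lemma linear_G: "linear G"
  unfolding G_def
  by (intro linear_compose_add linear_compose_sum linear_sandwich linear_mult_left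
      linear_mult_right ballI)

lemma adj_G: "adj (G X) = G (adj X)"
  by (simp add: G_def adj_add adj_sum adj_mult matrix_mul_assoc add.commute)

lemma csmult_G: "csmult c (G X) = G (csmult c X)"
  by (simp add: G_def csmult_add csmult_sum csmult_mult_left csmult_mult_right)

lemma mtrace_G: "mtrace (G X) = 0"
proof -
  have "mtrace (X ** adj K) = mtrace (adj K ** X)"
    by (rule mtrace_mult_commute)
  moreover have "mtrace (L k ** X ** adj (L k)) = mtrace (adj (L k) ** L k ** X)" for k
    using mtrace_mult_commute[of "L k ** X" "adj (L k)"] by (simp add: matrix_mul_assoc)
  ultimately have "mtrace (G X) = mtrace ((K + adj K + (\<Sum>k<M. adj (L k) ** L k)) ** X)"
    by (simp add: G_def mtrace_add mtrace_sum matrix_add_rdistrib matrix_mult_sum_right)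
  then show ?thesis
    by (simp add: balance mtrace_zero)
qed

text \<open>Cauchy-Schwarz with the test vector \<open>X *v v\<close> puts \<open>v\<close> in the
  kernel of \<open>X\<close>. Both drift terms then vanish at \<open>v\<close>, and only the
  positive jump terms remain: on the boundary of the positive cone, \<open>G\<close> does not point
  outwards.\<close>

lemma inner_G_nonneg:
  assumes "psd X" "v \<bullet> (X *v v) = 0"
  shows "0 \<le> v \<bullet> (G X *v v)"
proof -
  have "((X *v v) \<bullet> (X *v v))\<^sup>2 \<le> 0"
    using psd_Cauchy_Schwarz[OF assms(1), of "X *v v" v] assms(2) by simp
  then have Xv: "X *v v = 0"
    by simp
  have "v \<bullet> ((X ** adj K) *v v) = 0"
    using hermitian_inner_commute[of X v "adj K *v v"] assms(1) Xv
    by (simp add: psd_iff matrix_vector_mul_assoc[symmetric])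
  moreover have "0 \<le> v \<bullet> ((L k ** X ** adj (L k)) *v v)" for k
    using psd_sandwich[OF assms(1), of "L k"] by (simp add: psd_iff)
  ultimately show ?thesis
    using Xv
    by (simp add: G_def matrix_vector_mult_add_rdistrib sum_mult_vector inner_add_right
        inner_sum_right sum_nonneg matrix_vector_mul_assoc[symmetric, of K])
qed

text \<open>Since \<open>G\<close> commutes with \<open>adj\<close>, the difference of the solution
  and its adjoint solves the same equation with initial value 0.\<close>

lemma hermitian_preserved:
  assumes sol: "is_solution G \<rho>" and h: "hermitian (\<rho> 0)" and t: "0 \<le> t"
  shows "hermitian (\<rho> t)"
proof -
  have adj: "bounded_linear (adj :: 'n cmat \<Rightarrow> 'n cmat)"
    by (simp add: linear_conv_bounded_linear[symmetric] linearI adj_add adj_scaleR)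
  have "\<rho> t - adj (\<rho> t) = 0"
  proof (rule linear_ode_zero[where y = "\<lambda>t. \<rho> t - adj (\<rho> t)", OF linear_G _ _ t])
    show "((\<lambda>t. \<rho> t - adj (\<rho> t)) has_vector_derivative G (\<rho> s - adj (\<rho> s))) (at s within {0..})"
      if "0 \<le> s" for s
      unfolding linear_diff[OF linear_G] adj_G[symmetric]
      by (intro has_vector_derivative_diff is_solutionD[OF sol that]
          bounded_linear.has_vector_derivative[OF adj])
    show "\<rho> 0 - adj (\<rho> 0) = 0"
      using h by (simp add: hermitian_def)
  qed
  then show ?thesis
    by (simp add: hermitian_def)
qed

text \<open>Adding \<open>\<epsilon> e\<^bsup>c t\<^esup>\<close> times the identity makes the form strictly positive at time \<open>0\<close>;
  at the first time where it touches \<open>0\<close> its derivative would be strictly positive.\<close>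

lemma psd_preserved:
  assumes sol: "is_solution G \<rho>" and psd0: "psd (\<rho> 0)" and t: "0 \<le> t"
  shows "psd (\<rho> t)"
proof -
  have herm: "hermitian (\<rho> s)" if "0 \<le> s" for s
    using hermitian_preserved[OF sol _ that] psd0 by (simp add: psd_iff)
  \<comment> \<open>With this \<open>c\<close> the growth of the shift outweighs the action of
    \<open>G\<close> on the added identity.\<close>
  obtain c where c: "\<And>v. norm v = 1 \<Longrightarrow> v \<bullet> (G (mat 1) *v v) < c"
  proof -
    obtain B where B: "\<And>v. norm (G (mat 1) *v v) \<le> norm v * B"
      using bounded_linear.bounded[OF matrix_vector_mul_bounded_linear[of "G (mat 1)"]] by blast
    have "v \<bullet> (G (mat 1) *v v) \<le> B" if "norm v = 1" for v
      using norm_cauchy_schwarz[of v "G (mat 1) *v v"] B[of v] that by simp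
    then show ?thesis
      using that[of "B + 1"] by fastforce
  qed
  have pos: "0 < v \<bullet> (\<rho> t *v v) + \<epsilon> * exp (c * t)" if "0 < \<epsilon>" "norm v = 1" for \<epsilon> v
  proof (rule ccontr)
    assume neg: "\<not> ?thesis"
    define q where "q = (\<lambda>(s, v). v \<bullet> (\<rho> s *v v) + \<epsilon> * exp (c * s))"
    define S where "S = {p \<in> {0..t} \<times> sphere 0 1. q p \<le> 0}"
    have cont_\<rho>: "continuous_on {0..} \<rho>"
      using is_solutionD[OF sol] by (intro continuous_on_vector_derivative) auto
    have bil: "bounded_bilinear ((*v) :: 'n cmat \<Rightarrow> complex ^ 'n \<Rightarrow> complex ^ 'n)"
      unfolding bilinear_conv_bounded_bilinear[symmetric] bilinear_def
      by (auto intro!: linearI simp: matrix_vector_mult_add_rdistrib scaleR_mult_vector)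
    have cont_q: "continuous_on ({0..} \<times> UNIV) q"
      unfolding q_def split_beta
      by (intro continuous_intros bounded_bilinear.continuous_on[OF bil]
          continuous_on_compose2[OF cont_\<rho>]) auto
    have "S = ({0..t} \<times> sphere 0 1) \<inter> q -` {..0}"
      by (auto simp: S_def)
    moreover have "closed (({0..t} \<times> sphere 0 1) \<inter> q -` {..0})"
      by (intro continuous_closed_preimage continuous_on_subset[OF cont_q] closed_Times) auto
    moreover have "bounded S"
      by (rule bounded_subset[of "{0..t} \<times> sphere 0 1"]) (auto simp: S_def intro: bounded_Times)
    ultimately have "compact S"
      by (simp add: compact_eq_bounded_closed)
    then have "compact (fst ` S)"
      by (intro compact_continuous_image continuous_intros)
    moreover have "(t, v) \<in> S"
      using neg that t by (simp add: S_def q_def)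
    ultimately obtain t0 v0 where tv: "(t0, v0) \<in> S" and first: "\<And>s w. (s, w) \<in> S \<Longrightarrow> t0 \<le> s"
      using compact_attains_inf[of "fst ` S"] by fastforce
    have t0: "0 \<le> t0" "t0 \<le> t" and v0: "norm v0 = 1" and q0: "q (t0, v0) \<le> 0"
      using tv by (auto simp: S_def)
    have q_pos: "0 < q (s, w)" if "0 \<le> s" "s < t0" "norm w = 1" for s w
      using first[of s w] that t0 by (fastforce simp: S_def)
    have "0 < q (0, v0)"
    proof -
      have "0 \<le> v0 \<bullet> (\<rho> 0 *v v0)"
        using psd0 by (simp add: psd_iff)
      then show ?thesis
        using \<open>0 < \<epsilon>\<close> by (simp add: q_def)
    qed
    then have "0 < t0"
      using q0 t0 by (cases "t0 = 0") auto
    \<comment> \<open>Nonnegativity is needed in every direction at \<open>t0\<close>, not only at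
      \<open>v0\<close>, to make the shifted matrix \<open>\<sigma>\<close> positive semidefinite.
      It is inherited from earlier times by left limits.\<close>
    have q_nonneg: "0 \<le> q (t0, w)" if "norm w = 1" for w
    proof (rule tendsto_lowerbound)
      have "continuous_on {0..} (\<lambda>s. q (s, w))"
        by (intro continuous_on_compose2[OF cont_q] continuous_intros) auto
      then have "continuous (at t0 within {0..}) (\<lambda>s. q (s, w))"
        using t0 by (simp add: continuous_on_eq_continuous_within)
      then have "((\<lambda>s. q (s, w)) \<longlongrightarrow> q (t0, w)) (at t0)"
        using at_within_interior[of t0 "{0..}"] \<open>0 < t0\<close>
        by (simp add: continuous_within interior_real_atLeast)
      then show "((\<lambda>s. q (s, w)) \<longlongrightarrow> q (t0, w)) (at_left t0)"
        by (simp add: filterlim_at_split)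
      show "\<forall>\<^sub>F s in at_left t0. 0 \<le> q (s, w)"
        using eventually_at_left_real[OF \<open>0 < t0\<close>]
        by eventually_elim (auto intro!: less_imp_le q_pos that)
    qed simp
    define \<sigma> where "\<sigma> = \<rho> t0 + (\<epsilon> * exp (c * t0)) *\<^sub>R mat 1"
    have \<sigma>_form: "w \<bullet> (\<sigma> *v w) = w \<bullet> (\<rho> t0 *v w) + \<epsilon> * exp (c * t0) * (w \<bullet> w)" for w
      by (simp add: \<sigma>_def matrix_vector_mult_add_rdistrib scaleR_mult_vector inner_add_right)
    have \<sigma>_unit: "w \<bullet> (\<sigma> *v w) = q (t0, w)" if "norm w = 1" for w
      using that by (simp add: \<sigma>_form q_def power2_norm_eq_inner[symmetric])
    have "psd \<sigma>"
    proof (rule psd_of_unit_vectors)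
      show "hermitian \<sigma>"
        using herm[OF t0(1)] by (simp add: hermitian_def \<sigma>_def adj_add adj_scaleR)
    qed (simp add: \<sigma>_unit q_nonneg)
    moreover have "v0 \<bullet> (\<sigma> *v v0) = 0"
      using q0 q_nonneg[OF v0] \<sigma>_unit[OF v0] by simp
    ultimately have "0 \<le> v0 \<bullet> (G \<sigma> *v v0)"
      by (rule inner_G_nonneg)
    also have "\<dots> = v0 \<bullet> (G (\<rho> t0) *v v0) + \<epsilon> * exp (c * t0) * (v0 \<bullet> (G (mat 1) *v v0))"
      by (simp add: \<sigma>_def linear_add[OF linear_G] linear_scale[OF linear_G]
          matrix_vector_mult_add_rdistrib scaleR_mult_vector inner_add_right)
    also have "\<dots> < v0 \<bullet> (G (\<rho> t0) *v v0) + \<epsilon> * exp (c * t0) * c"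
      using c[OF v0] \<open>0 < \<epsilon>\<close> by simp
    finally have der_pos: "0 < v0 \<bullet> (G (\<rho> t0) *v v0) + \<epsilon> * exp (c * t0) * c" .
    have "bounded_linear (\<lambda>X. v0 \<bullet> (X *v v0))"
      using bounded_linear_compose[OF bounded_linear_inner_right
          bounded_bilinear.bounded_linear_left[OF bil]] .
    from bounded_linear.has_vector_derivative[OF this
        has_vector_derivative_nonneg_at[OF is_solutionD[OF sol t0(1)] \<open>0 < t0\<close>]]
    have "((\<lambda>s. v0 \<bullet> (\<rho> s *v v0)) has_real_derivative v0 \<bullet> (G (\<rho> t0) *v v0)) (at t0)"
      by (simp add: has_real_derivative_iff_has_vector_derivative)
    then have "((\<lambda>s. q (s, v0)) has_real_derivative
        v0 \<bullet> (G (\<rho> t0) *v v0) + \<epsilon> * exp (c * t0) * c) (at t0)"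
      unfolding q_def split by (auto intro!: derivative_eq_intros)
    \<comment> \<open>A positive derivative makes the form negative shortly before
      \<open>t0\<close>, against the minimality of \<open>t0\<close>.\<close>
    from DERIV_pos_inc_left[OF this der_pos]
    obtain d where d: "0 < d" "\<And>h. 0 < h \<Longrightarrow> h < d \<Longrightarrow> q (t0 - h, v0) < q (t0, v0)"
      by auto
    define h where "h = min t0 d / 2"
    have "0 < h" "h < d" "h < t0"
      using d(1) \<open>0 < t0\<close> by (auto simp: h_def min_def)
    then show False
      using d(2)[of h] q_pos[of "t0 - h" v0] v0 q0 by simp
  qed
  have unit: "0 \<le> v \<bullet> (\<rho> t *v v)" if "norm v = 1" for v
  proof (rule field_le_epsilon)
    fix e :: real assume "0 < e"
    then show "0 \<le> v \<bullet> (\<rho> t *v v) + e"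
      using pos[of "e / exp (c * t)" v] that by (simp add: field_simps)
  qed
  show ?thesis
    using herm[OF t] unit by (rule psd_of_unit_vectors)
qed

end

lemma csmult_eq_zero_iff: "csmult c A = 0 \<longleftrightarrow> c = 0 \<or> A = 0"
  by (auto simp: vec_eq_iff)

lemma has_vector_derivative_linear_image:
  fixes F :: "'a::euclidean_space \<Rightarrow> 'b::real_normed_vector"
  assumes "linear F" "(f has_vector_derivative f') net"
  shows "((\<lambda>t. F (f t)) has_vector_derivative F f') net"
  using assms by (simp add: bounded_linear.has_vector_derivative linear_conv_bounded_linear)

context gksl begin

lemma solution_exists:
  obtains y where "y 0 = X" "is_solution G y"
  using linear_ode_exists[OF linear_G, of X]
  by (metis has_vector_derivative_at_within is_solution_def)

lemma density_preserved:
  assumes sol: "is_solution G \<rho>" and dens: "density (\<rho> 0)" and t: "0 \<le> t"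
  shows "density (\<rho> t)"
proof -
  have "((\<lambda>s. mtrace (\<rho> s)) has_derivative (\<lambda>h. 0)) (at s within {0..})" if "s \<in> {0..}" for s
    using has_vector_derivative_linear_image[OF linear_mtrace is_solutionD[OF sol]] that
    by (fastforce simp: has_vector_derivative_def mtrace_G)
  then have "mtrace (\<rho> t) = mtrace (\<rho> 0)"
    using has_derivative_zero_constant[of "{0..}" "\<lambda>s. mtrace (\<rho> s)"] t
    by (metis atLeast_iff convex_real_interval(1) order_refl)
  then show ?thesis
    using psd_preserved[OF sol _ t] dens by (simp add: density_def)
qed

end

section \<open>The block of the generator transversal to the target subspace\<close>

locale gksl_proj = gksl K L M for K :: "'n::finite cmat" and L M +
  fixes P :: "'n cmat"
  assumes proj: "orth_proj P"
begin

definition Q :: "'n cmat" where "Q = mat 1 - P"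

lemma adj_P [simp]: "adj P = P" and P_P [simp]: "P ** P = P"
  using proj by (auto simp: orth_proj_def hermitian_def)

lemma adj_Q [simp]: "adj Q = Q" and Q_Q [simp]: "Q ** Q = Q" and P_Q [simp]: "P ** Q = 0"
  and Q_P [simp]: "Q ** P = 0"
  by (simp_all add: Q_def adj_diff matrix_mult_diff_left matrix_mult_diff_right)

lemma proj_simps [simp]: "X ** P ** P = X ** P" "X ** Q ** Q = X ** Q"
  "X ** P ** Q = 0" "X ** Q ** P = 0"
  by (simp_all flip: matrix_mul_assoc)

section \<open>Weight outside the target subspace and distance to it\<close>

lemma mtrace_Q: "mtrace (Q ** X) = mtrace X - mtrace (P ** X)"
  by (simp add: Q_def matrix_mult_diff_right mtrace_diff)

lemma mtrace_Q_sandwich: "mtrace (Q ** X ** Q) = mtrace (Q ** X)"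
  using mtrace_mult_commute[of "Q ** X" Q] by (simp add: matrix_mul_assoc)

lemma mtrace_P_sandwich: "mtrace (P ** X ** P) = mtrace (P ** X)"
  using mtrace_mult_commute[of "P ** X" P] by (simp add: matrix_mul_assoc)

lemma mtrace_Q_nonneg: "psd X \<Longrightarrow> 0 \<le> Re (mtrace (Q ** X))"
  using psd_mtrace_nonneg[OF psd_sandwich, of X Q] by (simp add: mtrace_Q_sandwich)

text \<open>With \<open>mat 1\<close> as the second factor the other trace is that of a density,
  namely 1. Hence \<open>q = 0\<close> kills all of \<open>Q ** X\<close>, off-diagonal block
  included.\<close>

lemma norm_Q_mult_le:
  assumes "density X"
  shows "(norm (Q ** X))\<^sup>2 \<le> 2 * Re (mtrace (Q ** X))"
  using psd_sandwich_norm_bound[of X Q "mat 1"] assms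
  by (simp add: density_def mtrace_Q_sandwich)

text \<open>The difference \<open>X - P ** X ** P\<close> splits into \<open>Q ** X\<close> and
  \<open>P ** X ** Q\<close>. Each has squared norm at most \<open>2 * q\<close>, because the traces
  on \<open>P\<close> and \<open>Q\<close> add up to 1, and is bounded generously by
  \<open>2 * sqrt q\<close>.\<close>

lemma dist0_le:
  assumes "density X"
  shows "dist0 P X \<le> 4 * sqrt (Re (mtrace (Q ** X)))"
proof -
  let ?q = "Re (mtrace (Q ** X))"
  have psd: "psd X" and tr: "mtrace X = 1"
    using assms by (auto simp: density_def)
  have q: "0 \<le> ?q"
    by (rule mtrace_Q_nonneg[OF psd])
  have sq: "norm Y \<le> 2 * sqrt ?q" if "(norm Y)\<^sup>2 \<le> 2 * ?q" for Y :: "'n cmat"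
  proof (rule power2_le_imp_le)
    show "(norm Y)\<^sup>2 \<le> (2 * sqrt ?q)\<^sup>2"
      using that q by (simp add: power_mult_distrib)
  qed (use q in simp)
  have "(norm (P ** X ** Q))\<^sup>2 \<le> 2 * Re (mtrace (P ** X)) * ?q"
    using psd_sandwich_norm_bound[OF psd, of P Q]
    by (simp add: mtrace_Q_sandwich mtrace_P_sandwich)
  also have "\<dots> \<le> 2 * 1 * ?q"
    using q mtrace_Q[of X] tr by (intro mult_right_mono) auto
  finally have "norm (P ** X ** Q) \<le> 2 * sqrt ?q"
    by (intro sq) simp
  moreover have "norm (Q ** X) \<le> 2 * sqrt ?q"
    by (intro sq norm_Q_mult_le assms)
  moreover have "X - P ** X ** P = Q ** X + P ** X ** Q"
    by (simp add: Q_def matrix_mult_diff_left matrix_mult_diff_right)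
  ultimately show ?thesis
    unfolding dist0_def using norm_triangle_ineq[of "Q ** X" "P ** X ** Q"] by simp
qed

lemma linear_Re_mtrace_Q: "linear (\<lambda>X. Re (mtrace (Q ** X)))"
  by (rule linearI)
    (simp_all add: matrix_add_ldistrib matrix_mult_scaleR_right mtrace_add mtrace_scaleR)

lemma mtrace_Q_le_dist0:
  obtains C where "0 < C" "\<And>X. Re (mtrace (Q ** X)) \<le> C * dist0 P X"
proof -
  have "bounded_linear (\<lambda>X. Re (mtrace (Q ** X)))"
    using linear_Re_mtrace_Q by (simp add: linear_conv_bounded_linear)
  from bounded_linear.pos_bounded[OF this]
  obtain C where C: "0 < C" "\<And>X. \<bar>Re (mtrace (Q ** X))\<bar> \<le> norm X * C"
    by auto
  have "Re (mtrace (Q ** X)) \<le> C * dist0 P X" for X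
  proof -
    \<comment> \<open>The last summand is \<open>Q ** P ** X ** P\<close> with
      \<open>Q ** P = 0\<close> already inserted.\<close>
    have "Q ** X = Q ** (X - P ** X ** P) + 0 ** X ** P"
      by (simp add: matrix_mult_diff_left matrix_mul_assoc)
    then show ?thesis
      using C(2)[of "X - P ** X ** P"] by (simp add: dist0_def mult.commute)
  qed
  then show ?thesis
    using C(1) that by blast
qed

text \<open>The solution starting at the normalised projection stays supported on the target subspace;
  its derivative at time \<open>0\<close> already determines the block structure of all operators.\<close>

lemma invariant_block_structure:
  assumes inv: "invariant P G" and "P \<noteq> 0"
  shows "k < M \<Longrightarrow> Q ** L k ** P = 0" and "Q ** K ** P = 0"
proof -
  define \<tau> where "\<tau> = (norm P)\<^sup>2"
  have "0 < \<tau>"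
    using \<open>P \<noteq> 0\<close> by (simp add: \<tau>_def)
  have trP: "mtrace P = of_real \<tau>"
    using mtrace_mult_adj[of P] by (simp add: \<tau>_def)
  have "psd P"
    using psd_sandwich[OF psd_mat_1, of P] by simp
  then have dens: "density (P /\<^sub>R \<tau>)"
    using \<open>0 < \<tau>\<close>
    by (simp add: density_def psd_scaleR mtrace_scaleR trP scaleR_conv_of_real[where 'a = complex])
  have P0: "mtrace (P ** (P /\<^sub>R \<tau>)) = 1"
    using \<open>0 < \<tau>\<close> by (simp add: matrix_mult_scaleR_right mtrace_scaleR trP scaleR_conv_of_real[where 'a = complex])
  obtain y where y0: "y 0 = P /\<^sub>R \<tau>" and sol: "is_solution G y"
    by (rule solution_exists)
  have Qy: "Q ** y t = 0" if "t \<in> {0..}" for t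
  proof -
    have dens_t: "density (y t)"
      using density_preserved[OF sol] dens y0 that by simp
    have "mtrace (P ** y t) = 1"
      using inv sol dens P0 y0 that by (simp add: invariant_def)
    then have "mtrace (Q ** y t) = 0"
      using dens_t by (simp add: mtrace_Q density_def)
    then show ?thesis
      using norm_Q_mult_le[OF dens_t] by simp
  qed
  have "((\<lambda>t. Q ** y t) has_vector_derivative Q ** G (y 0)) (at 0 within {0..})"
    using has_vector_derivative_linear_image[OF linear_mult_left is_solutionD[OF sol]] by simp
  moreover have "((\<lambda>t. Q ** y t) has_vector_derivative 0) (at 0 within {0..})"
    by (rule has_vector_derivative_transform[OF _ _ has_vector_derivative_const]) (simp_all add: Qy)
  moreover have "at (0 :: real) within {0..} \<noteq> bot"
    by (simp add: at_within_Ici_at_right)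
  ultimately have "Q ** G (y 0) = 0"
    using vector_derivative_unique_within by blast
  then have QGP: "Q ** G P = 0"
    using \<open>0 < \<tau>\<close> by (simp add: y0 linear_scale[OF linear_G] matrix_mult_scaleR_right)
  \<comment> \<open>In the \<open>Q\<close>-corner the drift terms contain \<open>P ** Q\<close> or
    \<open>Q ** P\<close> and drop out. What remains is a sum of positive terms, whose trace
    vanishes only if every term does.\<close>
  have "Q ** G P ** Q = (\<Sum>k<M. (Q ** L k ** P) ** adj (Q ** L k ** P))"
    by (simp add: G_def matrix_distribs adj_mult matrix_mul_assoc)
  then have "(\<Sum>k<M. mtrace ((Q ** L k ** P) ** adj (Q ** L k ** P))) = 0"
    by (simp add: QGP mtrace_zero flip: mtrace_sum)
  then have "(\<Sum>k<M. (norm (Q ** L k ** P))\<^sup>2) = 0"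
    unfolding mtrace_mult_adj of_real_sum[symmetric] by (simp only: of_real_eq_0_iff)
  then have QLP: "\<forall>k<M. Q ** L k ** P = 0"
    by (simp add: sum_nonneg_eq_0_iff)
  then show "k < M \<Longrightarrow> Q ** L k ** P = 0"
    by simp
  have "Q ** G P = Q ** K ** P"
    using QLP by (simp add: G_def matrix_distribs matrix_mul_assoc)
  then show "Q ** K ** P = 0"
    using QGP by simp
qed

text \<open>The second summand makes \<open>T\<close> injective on all matrices exactly when the compression of \<open>G\<close>
  is injective on the \<open>Q\<close>-block.\<close>

definition T :: "'n cmat \<Rightarrow> 'n cmat" where
  "T X = Q ** G (Q ** X ** Q) ** Q - (X - Q ** X ** Q)"

lemma linear_T: "linear T"
proof -
  have "linear (\<lambda>X. Q ** G (Q ** X ** Q) ** Q)"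
    using linear_compose[OF linear_compose[OF linear_sandwich linear_G] linear_sandwich]
    by (simp add: o_def)
  then show ?thesis
    unfolding T_def by (intro linear_compose_sub linear_ident linear_sandwich)
qed

lemma T_adj: "T (adj X) = adj (T X)"
  by (simp add: T_def adj_diff adj_mult adj_G matrix_mul_assoc)

lemma T_csmult: "T (csmult c X) = csmult c (T X)"
  by (simp add: T_def csmult_diff csmult_mult_left csmult_mult_right flip: csmult_G)

end

text \<open>The two identities say that \<open>K\<close> and the \<open>L k\<close> map the range of
  \<open>P\<close> into itself, that is, they are block triangular.\<close>

locale gksl_block = gksl_proj K L M P for K :: "'n::finite cmat" and L M P +
  assumes QLP: "k < M \<Longrightarrow> Q ** L k ** P = 0" and QKP: "Q ** K ** P = 0"
begin

lemma Q_mult_block: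
  assumes "Q ** A ** P = 0"
  shows "Q ** A ** Q = Q ** A" "Q ** adj A ** Q = adj A ** Q"
proof -
  show *: "Q ** A ** Q = Q ** A"
    using assms by (simp add: Q_def matrix_mult_diff_left)
  show "Q ** adj A ** Q = adj A ** Q"
    using arg_cong[OF *, of adj] by (simp add: adj_mult matrix_mul_assoc)
qed

text \<open>Triangularity allows a factor \<open>Q\<close> to be inserted on both sides of
  \<open>X\<close> in every term. This is why the \<open>Q\<close>-block of a solution obeys a
  linear equation of its own.\<close>

lemma Q_G_block: "Q ** G (Q ** X ** Q) ** Q = Q ** G X ** Q"
proof -
  have block: "Q ** A ** (Q ** X ** Q) ** adj A ** Q = Q ** A ** X ** adj A ** Q"
    if "Q ** A ** P = 0" for A
  proof -
    have "Q ** A ** (Q ** X ** Q) ** adj A ** Q = (Q ** A ** Q) ** X ** (Q ** adj A ** Q)"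
      by (simp add: matrix_mul_assoc)
    then show ?thesis
      by (simp add: Q_mult_block[OF that] matrix_mul_assoc)
  qed
  have "Q ** K ** (Q ** X ** Q) ** Q = (Q ** K ** Q) ** X ** Q"
    by (simp add: matrix_mul_assoc)
  then have 1: "Q ** K ** (Q ** X ** Q) ** Q = Q ** K ** X ** Q"
    by (simp add: Q_mult_block[OF QKP])
  have "Q ** (Q ** X ** Q) ** adj K ** Q = Q ** X ** (Q ** adj K ** Q)"
    by (simp add: matrix_mul_assoc)
  then have 2: "Q ** (Q ** X ** Q) ** adj K ** Q = Q ** X ** adj K ** Q"
    by (simp add: Q_mult_block[OF QKP] matrix_mul_assoc)
  have expand: "Q ** G Y ** Q = Q ** K ** Y ** Q + Q ** Y ** adj K ** Q
      + (\<Sum>k<M. Q ** L k ** Y ** adj (L k) ** Q)" for Y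
    by (simp add: G_def matrix_distribs matrix_mul_assoc)
  show ?thesis
    unfolding expand 1 2 using block[OF QLP] by simp
qed

text \<open>As \<open>G\<close> has trace 0, the change of weight on \<open>Q\<close> is minus the
  change on \<open>P\<close>. Starting from a matrix supported on \<open>Q\<close>, only jumps reach
  the \<open>P\<close>-corner, and they contribute positive matrices.\<close>

lemma mtrace_Q_G_nonpos:
  assumes "psd X"
  shows "Re (mtrace (Q ** G X)) \<le> 0"
proof -
  define Y where "Y = Q ** X ** Q"
  have "psd Y"
    using psd_sandwich[OF assms, of Q] by (simp add: Y_def)
  have YP: "A ** Y ** P = 0" and PY: "P ** Y = 0" for A
    by (simp_all add: Y_def matrix_mul_assoc)
  have "mtrace (Q ** G X) = mtrace (Q ** G Y)"
    using Q_G_block[of X] by (metis Y_def mtrace_Q_sandwich)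
  also have "\<dots> = - mtrace (P ** G Y ** P)"
    by (simp add: mtrace_Q mtrace_G mtrace_P_sandwich)
  also have "P ** G Y ** P = (\<Sum>k<M. (P ** L k) ** Y ** adj (P ** L k))"
    by (simp add: G_def matrix_distribs YP PY adj_mult matrix_mul_assoc)
  finally show ?thesis
    using psd_mtrace_nonneg[OF psd_sandwich[OF \<open>psd Y\<close>]] by (simp add: mtrace_sum sum_nonneg)
qed

lemma T_block: "T (Q ** X ** Q) = Q ** G X ** Q"
  using Q_G_block[of X] by (simp add: T_def matrix_mul_assoc)

lemma mtrace_Q_antimono:
  assumes sol: "is_solution G \<rho>" and dens: "density (\<rho> 0)" and "0 \<le> s" "s \<le> t"
  shows "Re (mtrace (Q ** \<rho> t)) \<le> Re (mtrace (Q ** \<rho> s))"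
proof (rule nonneg_line_antimono[where f = "\<lambda>t. Re (mtrace (Q ** \<rho> t))"
      and f' = "\<lambda>t. Re (mtrace (Q ** G (\<rho> t)))"])
  show "((\<lambda>t. Re (mtrace (Q ** \<rho> t))) has_vector_derivative Re (mtrace (Q ** G (\<rho> t))))
      (at t within {0..})" if "0 \<le> t" for t
    by (rule has_vector_derivative_linear_image[OF linear_Re_mtrace_Q is_solutionD[OF sol that]])
  show "Re (mtrace (Q ** G (\<rho> x))) \<le> 0" if "s < x" for x
    using density_preserved[OF sol dens, of x] that \<open>0 \<le> s\<close>
    by (intro mtrace_Q_G_nonpos) (simp add: density_def)
qed fact+

text \<open>With \<open>S\<close> inverse to \<open>T\<close>, the bounded function \<open>u = Re (tr (Q S(Q \<rho> Q)))\<close> has derivative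
  \<open>q = Re (tr (Q \<rho>))\<close>; since \<open>q\<close> is nonincreasing, \<open>t q(t) \<le> u(t) - u(0)\<close>.\<close>

lemma mtrace_Q_decay:
  assumes inj: "inj T"
  obtains C where "\<And>\<rho> t. is_solution G \<rho> \<Longrightarrow> density (\<rho> 0) \<Longrightarrow> 0 \<le> t \<Longrightarrow>
    t * Re (mtrace (Q ** \<rho> t)) \<le> C"
proof -
  define \<phi> where "\<phi> = (\<lambda>X. Re (mtrace (Q ** inv T (Q ** X ** Q))))"
  have "linear (inv T)"
    using inj_linear_imp_inv_bounded_linear[of T] linear_T inj
    by (simp add: linear_conv_bounded_linear)
  then have lin: "linear \<phi>"
    unfolding \<phi>_def
    by (intro linearI)
      (simp_all add: matrix_add_ldistrib matrix_add_rdistrib matrix_mult_scaleR_left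
        matrix_mult_scaleR_right mtrace_add mtrace_scaleR linear_add linear_scale)
  then obtain B where B: "0 < B" "\<And>X. \<bar>\<phi> X\<bar> \<le> norm X * B"
    using bounded_linear.pos_bounded[of \<phi>] by (auto simp: linear_conv_bounded_linear)
  \<comment> \<open>By \<open>T_block\<close>, \<open>inv T\<close> sends the \<open>Q\<close>-block
    of \<open>G X\<close> back to the \<open>Q\<close>-block of \<open>X\<close>.\<close>
  have \<phi>_G: "\<phi> (G X) = Re (mtrace (Q ** X))" for X
    using inj by (simp add: \<phi>_def inv_f_f mtrace_Q_sandwich matrix_mul_assoc flip: T_block)
  \<comment> \<open>Densities have norm at most 2, so \<open>\<phi>\<close> is bounded by
    \<open>2 * B\<close> along the solution; it is evaluated at two times.\<close>
  have "t * Re (mtrace (Q ** \<rho> t)) \<le> 4 * B"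
    if sol: "is_solution G \<rho>" and dens: "density (\<rho> 0)" and t: "0 \<le> t" for \<rho> t
  proof -
    let ?q = "\<lambda>t. Re (mtrace (Q ** \<rho> t))"
    have bnd: "\<bar>\<phi> (\<rho> s)\<bar> \<le> 2 * B" if "0 \<le> s" for s
    proof -
      have "(norm (\<rho> s))\<^sup>2 \<le> 2\<^sup>2"
        using psd_norm_le[of "\<rho> s"] density_preserved[OF sol dens that] by (simp add: density_def)
      then have "norm (\<rho> s) \<le> 2"
        by (rule power2_le_imp_le) simp
      then have "norm (\<rho> s) * B \<le> 2 * B"
        using B(1) by simp
      then show ?thesis
        using B(2)[of "\<rho> s"] by linarith
    qed
    have "t * ?q t - \<phi> (\<rho> t) \<le> 0 * ?q t - \<phi> (\<rho> 0)"
    proof (rule nonneg_line_antimono[where f = "\<lambda>s. s * ?q t - \<phi> (\<rho> s)"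
          and f' = "\<lambda>s. ?q t - ?q s"])
      show "((\<lambda>s. s * ?q t - \<phi> (\<rho> s)) has_vector_derivative ?q t - ?q s) (at s within {0..})"
        if "0 \<le> s" for s
        using has_vector_derivative_linear_image[OF lin is_solutionD[OF sol that]]
        by (auto intro!: derivative_eq_intros simp: \<phi>_G)
      show "?q t - ?q s \<le> 0" if "0 < s" "s < t" for s
        using mtrace_Q_antimono[OF sol dens, of s t] that by simp
    qed (use t in auto)
    then show ?thesis
      using bnd[of t] bnd[of 0] t by simp
  qed
  then show ?thesis
    using that by blast
qed

text \<open>Stability comes from the monotone \<open>q\<close> and its two comparisons with the
  distance; injectivity drives the attraction through the bound on \<open>t * q\<close>.\<close>

lemma GAS_if_inj:
  assumes "invariant P G" and inj: "inj T"
  shows "GAS P G"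
  unfolding GAS_def
proof (intro conjI allI impI)
  show "invariant P G"
    by fact
  show "stable P G"
    unfolding stable_def
  proof (intro allI impI)
    fix \<epsilon> :: real assume "0 < \<epsilon>"
    obtain C where C: "0 < C" "\<And>X. Re (mtrace (Q ** X)) \<le> C * dist0 P X"
      using mtrace_Q_le_dist0 by blast
    \<comment> \<open>The radius is solved for backwards from \<open>4 * sqrt q < \<epsilon>\<close>
      and \<open>q \<le> C * dist0\<close>.\<close>
    have "dist0 P (\<rho> t) < \<epsilon>"
      if sol: "is_solution G \<rho>" and dens: "density (\<rho> 0)"
        and close: "dist0 P (\<rho> 0) < (\<epsilon> / 4)\<^sup>2 / C" and t: "0 \<le> t" for \<rho> t
    proof -
      have "Re (mtrace (Q ** \<rho> t)) \<le> Re (mtrace (Q ** \<rho> 0))"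
        by (rule mtrace_Q_antimono[OF sol dens _ t]) simp
      also have "\<dots> \<le> C * dist0 P (\<rho> 0)"
        by (rule C)
      also have "\<dots> < (\<epsilon> / 4)\<^sup>2"
        using close C(1) by (simp add: field_simps)
      finally have "sqrt (Re (mtrace (Q ** \<rho> t))) < \<epsilon> / 4"
        using \<open>0 < \<epsilon>\<close> by (intro real_less_lsqrt) auto
      then show ?thesis
        using dist0_le[OF density_preserved[OF sol dens t]] by simp
    qed
    then show "\<exists>\<delta>>0. \<forall>\<rho>. is_solution G \<rho> \<longrightarrow> density (\<rho> 0) \<longrightarrow> dist0 P (\<rho> 0) < \<delta> \<longrightarrow>
        (\<forall>t\<ge>0. dist0 P (\<rho> t) < \<epsilon>)"
      using \<open>0 < \<epsilon>\<close> C(1) by (intro exI[of _ "(\<epsilon> / 4)\<^sup>2 / C"]) auto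
  qed
  fix \<rho> assume sol: "is_solution G \<rho>" and dens: "density (\<rho> 0)"
  obtain C where C: "\<And>t. 0 \<le> t \<Longrightarrow> t * Re (mtrace (Q ** \<rho> t)) \<le> C"
    using mtrace_Q_decay[OF inj] sol dens by metis
  have "((\<lambda>t. Re (mtrace (Q ** \<rho> t))) \<longlongrightarrow> 0) at_top"
  proof (rule tendsto_sandwich)
    show "\<forall>\<^sub>F t in at_top. 0 \<le> Re (mtrace (Q ** \<rho> t))"
      using eventually_ge_at_top[of 0]
      by eventually_elim
        (use density_preserved[OF sol dens] in \<open>auto intro: mtrace_Q_nonneg simp: density_def\<close>)
    show "\<forall>\<^sub>F t in at_top. Re (mtrace (Q ** \<rho> t)) \<le> C / t"
      using eventually_gt_at_top[of 0]
      by eventually_elim (use C in \<open>simp add: field_simps\<close>)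
    show "((\<lambda>t. C / t) \<longlongrightarrow> 0) at_top"
      by (intro tendsto_divide_0[OF tendsto_const] filterlim_at_top_imp_at_infinity filterlim_ident)
  qed simp
  then have lim: "((\<lambda>t. 4 * sqrt (Re (mtrace (Q ** \<rho> t)))) \<longlongrightarrow> 4 * sqrt 0) at_top"
    by (intro tendsto_intros)
  show "((\<lambda>t. dist0 P (\<rho> t)) \<longlongrightarrow> 0) at_top"
  proof (rule tendsto_sandwich[OF _ _ tendsto_const])
    show "\<forall>\<^sub>F t in at_top. 0 \<le> dist0 P (\<rho> t)"
      by (simp add: dist0_def)
    show "\<forall>\<^sub>F t in at_top. dist0 P (\<rho> t) \<le> 4 * sqrt (Re (mtrace (Q ** \<rho> t)))"
      using eventually_ge_at_top[of 0]
      by eventually_elim (use dist0_le density_preserved[OF sol dens] in blast)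
  qed (use lim in simp)
qed

text \<open>Frees attraction from the normalisation: a positive matrix of positive trace is a
  multiple of a density, and the sandwich with \<open>Q\<close> annihilates the part supported on
  the target.\<close>

lemma GAS_Q_block_tendsto:
  assumes "GAS P G" and sol: "is_solution G y" and psd: "psd (y 0)" and pos: "0 < Re (mtrace (y 0))"
  shows "((\<lambda>t. Q ** y t ** Q) \<longlongrightarrow> 0) at_top"
proof -
  define \<tau> where "\<tau> = Re (mtrace (y 0))"
  define \<rho> where "\<rho> = (\<lambda>t. y t /\<^sub>R \<tau>)"
  have "mtrace (y 0) = of_real \<tau>"
    using psd hermitian_mtrace_real[of "y 0"] by (simp add: \<tau>_def psd_iff complex_eq_iff)
  then have "density (\<rho> 0)"
    using psd pos
    by (simp add: density_def \<rho>_def psd_scaleR mtrace_scaleR scaleR_conv_of_real[where 'a = complex] \<tau>_def[symmetric])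
  moreover have "is_solution G \<rho>"
    using has_vector_derivative_linear_image[OF linear_scaleR is_solutionD[OF sol]]
    unfolding is_solution_def \<rho>_def by (simp add: linear_scale[OF linear_G])
  ultimately have "((\<lambda>t. dist0 P (\<rho> t)) \<longlongrightarrow> 0) at_top"
    using \<open>GAS P G\<close> by (simp add: GAS_def)
  then have lim: "((\<lambda>t. \<rho> t - P ** \<rho> t ** P) \<longlongrightarrow> 0) at_top"
    unfolding dist0_def by (simp only: tendsto_norm_zero_iff)
  have "linear (\<lambda>X. \<tau> *\<^sub>R (Q ** X ** Q))"
    by (intro linear_compose_scale_right linear_sandwich)
  then have "bounded_linear (\<lambda>X. \<tau> *\<^sub>R (Q ** X ** Q))"
    by (simp add: linear_conv_bounded_linear)
  from bounded_linear.tendsto_zero[OF this lim]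
  show ?thesis
    using pos by (simp add: matrix_mult_diff_left matrix_mult_diff_right matrix_mul_assoc \<rho>_def
        matrix_mult_scaleR_left matrix_mult_scaleR_right \<tau>_def)
qed

text \<open>Two positive initial values differing by \<open>A\<close> both have
  \<open>Q\<close>-blocks tending to 0, while the difference of these blocks stays equal to
  \<open>A\<close>.\<close>

lemma hermitian_kernel_T_trivial:
  assumes gas: "GAS P G" and "hermitian A" and TA: "T A = 0"
  shows "A = 0"
proof -
  \<comment> \<open>Sandwiching with \<open>Q\<close> removes the second summand of
    \<open>T\<close>. Once the first is known to vanish, \<open>T A = 0\<close> reduces to
    \<open>Q ** A ** Q = A\<close>.\<close>
  have "Q ** T A ** Q = Q ** G A ** Q"
    using Q_G_block[of A] by (simp add: T_def matrix_mult_diff_left matrix_mult_diff_right matrix_mul_assoc)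
  then have QGA: "Q ** G A ** Q = 0"
    by (simp add: TA)
  then have A: "Q ** A ** Q = A"
    using TA Q_G_block[of A] by (simp add: T_def)
  obtain c where c: "0 < c" "psd (c *\<^sub>R mat 1 + A)" "0 < Re (mtrace (c *\<^sub>R mat 1 + A))"
    using hermitian_shift_psd[OF \<open>hermitian A\<close>] .
  obtain y where y0: "y 0 = c *\<^sub>R mat 1 + A" and y: "is_solution G y"
    by (rule solution_exists)
  obtain z where z0: "z 0 = c *\<^sub>R mat 1" and z: "is_solution G z"
    by (rule solution_exists)
  have ylim: "((\<lambda>t. Q ** y t ** Q) \<longlongrightarrow> 0) at_top"
    by (rule GAS_Q_block_tendsto[OF gas y]) (simp_all add: y0 c)
  have zlim: "((\<lambda>t. Q ** z t ** Q) \<longlongrightarrow> 0) at_top"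
  proof (rule GAS_Q_block_tendsto[OF gas z])
    show "psd (z 0)"
      unfolding z0 using c(1) by (intro psd_scaleR psd_mat_1) simp
    show "0 < Re (mtrace (z 0))"
      using c(1) by (simp add: z0 mtrace_scaleR mtrace_def mat_def)
  qed
  \<comment> \<open>\<open>A\<close> is stationary for the equation of the \<open>Q\<close>-block,
    so \<open>w\<close> solves that equation with initial value 0.\<close>
  define w where "w = (\<lambda>t. Q ** (y t - z t) ** Q - A)"
  have "w t = 0" if "0 \<le> t" for t
  proof (rule linear_ode_zero[where G = "\<lambda>X. Q ** G X ** Q" and y = w, OF _ _ _ that])
    show "linear (\<lambda>X. Q ** G X ** Q)"
      using linear_compose[OF linear_G linear_sandwich] by (simp add: o_def)
    have "Q ** G (w s) ** Q = Q ** (G (y s) - G (z s)) ** Q" for s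
    proof -
      have "Q ** G (w s) ** Q = Q ** G (Q ** (y s - z s) ** Q) ** Q"
        by (simp add: w_def linear_diff[OF linear_G] QGA matrix_mult_diff_left matrix_mult_diff_right)
      then show ?thesis
        by (simp add: Q_G_block linear_diff[OF linear_G])
    qed
    moreover have "(w has_vector_derivative Q ** (G (y s) - G (z s)) ** Q - 0) (at s within {0..})"
      if "0 \<le> s" for s
      unfolding w_def
      by (intro has_vector_derivative_diff has_vector_derivative_const
          has_vector_derivative_linear_image[OF linear_sandwich] is_solutionD that y z)
    ultimately show "(w has_vector_derivative Q ** G (w s) ** Q) (at s within {0..})"
      if "0 \<le> s" for s
      using that by simp
    show "w 0 = 0"
      by (simp add: w_def y0 z0 A)
  qed
  then have diff: "Q ** y t ** Q - Q ** z t ** Q = A" if "0 \<le> t" for t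
    using that by (simp add: w_def matrix_mult_diff_left matrix_mult_diff_right)
  have "\<forall>\<^sub>F t in at_top. Q ** y t ** Q - Q ** z t ** Q = A"
    by (rule eventually_mono[OF eventually_ge_at_top[of 0]]) (rule diff)
  then have "((\<lambda>t. Q ** y t ** Q - Q ** z t ** Q) \<longlongrightarrow> A) (at_top :: real filter)"
    by (rule tendsto_eventually)
  moreover have "((\<lambda>t. Q ** y t ** Q - Q ** z t ** Q) \<longlongrightarrow> 0) at_top"
    using tendsto_diff[OF ylim zlim] by simp
  ultimately show ?thesis
    using tendsto_unique trivial_limit_at_top_linorder by blast
qed

text \<open>\<open>T\<close> commutes with \<open>adj\<close> and with complex scaling, so a kernel
  element splits into a Hermitian part and \<open>\<i>\<close> times another, both in the
  kernel.\<close>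

lemma inj_if_GAS:
  assumes gas: "GAS P G"
  shows "inj T"
proof (subst linear_injective_0[OF linear_T], intro allI impI)
  fix X assume X: "T X = 0"
  have "X + adj X = 0"
  proof (rule hermitian_kernel_T_trivial[OF gas])
    show "hermitian (X + adj X)"
      by (simp add: hermitian_def adj_add add.commute)
    show "T (X + adj X) = 0"
      by (simp add: linear_add[OF linear_T] T_adj X)
  qed
  moreover have "csmult \<i> (X - adj X) = 0"
  proof (rule hermitian_kernel_T_trivial[OF gas])
    show "hermitian (csmult \<i> (X - adj X))"
      by (simp add: hermitian_def vec_eq_iff algebra_simps)
    show "T (csmult \<i> (X - adj X)) = 0"
      by (simp add: T_csmult linear_diff[OF linear_T] T_adj X)
  qed
  then have "X - adj X = 0"
    by (simp add: csmult_eq_zero_iff)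
  moreover have "2 *\<^sub>R X = (X + adj X) + (X - adj X)"
    by (simp add: scaleR_2)
  ultimately have "2 *\<^sub>R X = 0"
    by simp
  then show "X = 0"
    by simp
qed

end

section \<open>Polynomial functions\<close>

lemma polyfun_continuous: "polyfun f \<Longrightarrow> continuous_on UNIV f"
  by (induction rule: polyfun.induct) (auto intro!: continuous_intros)

lemma polyfun_on_line:
  assumes "polyfun f"
  obtains p where "\<And>s. f (a + s *\<^sub>R w) = poly p s"
proof -
  have "\<exists>p. \<forall>s. f (a + s *\<^sub>R w) = poly p s"
    using assms
  proof (induction rule: polyfun.induct)
    case (const c)
    show ?case
      by (intro exI[of _ "[:c:]"]) simp
  next
    case (coord i)
    show ?case
      by (intro exI[of _ "[:a $ i, w $ i:]"]) simp
  next
    case (add f g)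
    then show ?case
      by (metis poly_add)
  next
    case (mult f g)
    then show ?case
      by (metis poly_mult)
  qed
  then show ?thesis
    using that by blast
qed

text \<open>Every line through \<open>a\<close> meets the zero set in finitely many points, so by Fubini almost every
  dilation with centre \<open>a\<close> maps the zero set to a null set, and dilations preserve null sets.\<close>

lemma negligible_polyfun_zeros:
  fixes f :: "real ^ 'N \<Rightarrow> real"
  assumes f: "polyfun f" and a: "f a \<noteq> 0"
  shows "negligible {x. f x = 0}"
proof -
  have "continuous_on UNIV (\<lambda>p :: (real ^ 'N) \<times> real. f (a + snd p *\<^sub>R fst p))"
    by (intro continuous_on_compose2[OF polyfun_continuous[OF f]] continuous_intros) auto
  then have [measurable]: "(\<lambda>p :: (real ^ 'N) \<times> real. f (a + snd p *\<^sub>R fst p)) \<in> borel_measurable borel"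
    by (rule borel_measurable_continuous_onI)
  have "AE w in lborel. AE s in lborel. f (a + s *\<^sub>R w) \<noteq> 0"
  proof (rule AE_I2)
    fix w :: "real ^ 'N"
    obtain p where p: "\<And>s. f (a + s *\<^sub>R w) = poly p s"
      using polyfun_on_line[OF f] by blast
    \<comment> \<open>At \<open>s = 0\<close> every line, even the degenerate one with
      \<open>w = 0\<close>, passes through \<open>a\<close>.\<close>
    have "p \<noteq> 0"
      using p[of 0] a by auto
    then have "finite {s. f (a + s *\<^sub>R w) = 0}"
      unfolding p by (rule poly_roots_finite)
    then show "AE s in lborel. f (a + s *\<^sub>R w) \<noteq> 0"
      by (intro AE_I'[of "{s. f (a + s *\<^sub>R w) = 0}"]) (auto intro: finite_imp_null_set_lborel)
  qed
  moreover have "{p \<in> space (lborel \<Otimes>\<^sub>M lborel). f (a + snd p *\<^sub>R fst p) \<noteq> 0}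
      \<in> sets (lborel \<Otimes>\<^sub>M (lborel :: real measure))"
    unfolding lborel_prod by measurable
  ultimately have "AE s in lborel. AE w in lborel. f (a + s *\<^sub>R w) \<noteq> 0"
    by (subst (asm) lborel_pair.AE_commute) auto
  \<comment> \<open>Dilation by 0 collapses the space and could not be undone below.\<close>
  moreover have "AE s in lborel. s \<noteq> (0 :: real)"
    by (rule AE_lborel_singleton)
  ultimately have "AE s in lborel. s \<noteq> 0 \<and> (AE w in lborel. f (a + s *\<^sub>R w) \<noteq> 0)"
    by eventually_elim auto
  moreover have "ae_filter (lborel :: real measure) \<noteq> bot"
    by (simp add: ae_filter_eq_bot_iff)
  ultimately obtain s :: real where s: "s \<noteq> 0" and ae: "AE w in lborel. f (a + s *\<^sub>R w) \<noteq> 0"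
    using eventually_happens' by blast
  have "negligible {w. f (a + s *\<^sub>R w) = 0}"
    using AE_completion[OF ae] by (auto simp: eventually_ae_filter_negligible intro: negligible_subset)
  then have "negligible ((+) a ` (\<lambda>w. s *\<^sub>R w) ` {w. f (a + s *\<^sub>R w) = 0})"
    by (intro negligible_translation negligible_differentiable_image_negligible)
      (auto intro!: linear_imp_differentiable_on linear_scaleR)
  moreover have "{x. f x = 0} \<subseteq> (+) a ` (\<lambda>w. s *\<^sub>R w) ` {w. f (a + s *\<^sub>R w) = 0}"
  proof
    fix x assume "x \<in> {x. f x = 0}"
    then have "x = a + s *\<^sub>R ((x - a) /\<^sub>R s)" "f (a + s *\<^sub>R ((x - a) /\<^sub>R s)) = 0"
      using s by simp_all
    then show "x \<in> (+) a ` (\<lambda>w. s *\<^sub>R w) ` {w. f (a + s *\<^sub>R w) = 0}"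
      by blast
  qed
  ultimately show ?thesis
    by (rule negligible_subset)
qed

section \<open>Complex-valued polynomial functions and polynomial matrices\<close>

definition cpolyfun :: "(real ^ 'N \<Rightarrow> complex) \<Rightarrow> bool" where
  "cpolyfun f \<longleftrightarrow> polyfun (\<lambda>x. Re (f x)) \<and> polyfun (\<lambda>x. Im (f x))"

lemma polyfun_uminus: "polyfun f \<Longrightarrow> polyfun (\<lambda>x. - f x)"
  using polyfun.mult[OF polyfun.const[of "-1"]] by fastforce

lemma polyfun_diff: "polyfun f \<Longrightarrow> polyfun g \<Longrightarrow> polyfun (\<lambda>x. f x - g x)"
  using polyfun.add[OF _ polyfun_uminus] by fastforce

lemma cpolyfun_const: "cpolyfun (\<lambda>x. c)"
  by (simp add: cpolyfun_def polyfun.const)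

lemma cpolyfun_add: "cpolyfun f \<Longrightarrow> cpolyfun g \<Longrightarrow> cpolyfun (\<lambda>x. f x + g x)"
  by (simp add: cpolyfun_def polyfun.add)

lemma cpolyfun_diff: "cpolyfun f \<Longrightarrow> cpolyfun g \<Longrightarrow> cpolyfun (\<lambda>x. f x - g x)"
  by (simp add: cpolyfun_def polyfun_diff)

lemma cpolyfun_mult: "cpolyfun f \<Longrightarrow> cpolyfun g \<Longrightarrow> cpolyfun (\<lambda>x. f x * g x)"
  by (simp add: cpolyfun_def polyfun.add polyfun.mult polyfun_diff)

lemma cpolyfun_cnj: "cpolyfun f \<Longrightarrow> cpolyfun (\<lambda>x. cnj (f x))"
  by (simp add: cpolyfun_def polyfun_uminus)

lemma cpolyfun_sum: "(\<And>k. k \<in> I \<Longrightarrow> cpolyfun (f k)) \<Longrightarrow> cpolyfun (\<lambda>x. \<Sum>k\<in>I. f k x)"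
  by (induction I rule: infinite_finite_induct) (simp_all add: cpolyfun_const cpolyfun_add)

lemma cpolyfun_prod: "(\<And>k. k \<in> I \<Longrightarrow> cpolyfun (f k)) \<Longrightarrow> cpolyfun (\<lambda>x. \<Prod>k\<in>I. f k x)"
  by (induction I rule: infinite_finite_induct) (simp_all add: cpolyfun_const cpolyfun_mult)

text \<open>The real or the imaginary part is nonzero at \<open>a\<close>, and its zero set contains
  that of \<open>f\<close>.\<close>

lemma negligible_cpolyfun_zeros:
  assumes "cpolyfun f" "f a \<noteq> 0"
  shows "negligible {x. f x = 0}"
proof (cases "Re (f a) = 0")
  case True
  then have "negligible {x. Im (f x) = 0}"
    using assms by (intro negligible_polyfun_zeros[of _ a]) (auto simp: cpolyfun_def complex_eq_iff)
  then show ?thesis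
    by (rule negligible_subset) auto
next
  case False
  then have "negligible {x. Re (f x) = 0}"
    using assms by (intro negligible_polyfun_zeros[of _ a]) (auto simp: cpolyfun_def)
  then show ?thesis
    by (rule negligible_subset) auto
qed

lemma poly_matrix_fun_iff: "poly_matrix_fun F \<longleftrightarrow> (\<forall>i j. cpolyfun (\<lambda>x. F x $ i $ j))"
  by (simp add: poly_matrix_fun_def cpolyfun_def)

lemma poly_matrix_fun_intros:
  "poly_matrix_fun (\<lambda>x. A)"
  "poly_matrix_fun F \<Longrightarrow> poly_matrix_fun F' \<Longrightarrow> poly_matrix_fun (\<lambda>x. F x + F' x)"
  "poly_matrix_fun F \<Longrightarrow> poly_matrix_fun F' \<Longrightarrow> poly_matrix_fun (\<lambda>x. F x - F' x)"
  "poly_matrix_fun F \<Longrightarrow> poly_matrix_fun F' \<Longrightarrow> poly_matrix_fun (\<lambda>x. F x ** F' x)"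
  "poly_matrix_fun F \<Longrightarrow> poly_matrix_fun (\<lambda>x. adj (F x))"
  "poly_matrix_fun F \<Longrightarrow> poly_matrix_fun (\<lambda>x. csmult c (F x))"
  by (simp_all add: poly_matrix_fun_iff matrix_matrix_mult_def cpolyfun_const cpolyfun_add
      cpolyfun_diff cpolyfun_mult cpolyfun_cnj cpolyfun_sum)

lemma poly_matrix_fun_sum:
  "(\<And>k. k \<in> I \<Longrightarrow> poly_matrix_fun (F k)) \<Longrightarrow> poly_matrix_fun (\<lambda>x. \<Sum>k\<in>I. F k x)"
  by (simp add: poly_matrix_fun_iff cpolyfun_sum)

section \<open>The determinant of an operator on matrices\<close>

definition flatten :: "'n::finite cmat \<Rightarrow> complex ^ ('n \<times> 'n)" where
  "flatten X = (\<chi> p. X $ fst p $ snd p)"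

definition unflatten :: "complex ^ ('n \<times> 'n) \<Rightarrow> 'n::finite cmat" where
  "unflatten v = (\<chi> i j. v $ (i, j))"

definition flat_matrix :: "('n::finite cmat \<Rightarrow> 'n cmat) \<Rightarrow> complex ^ ('n \<times> 'n) ^ ('n \<times> 'n)" where
  "flat_matrix F = matrix (\<lambda>v. flatten (F (unflatten v)))"

lemma unflatten_flatten [simp]: "unflatten (flatten X) = X"
  by (simp add: flatten_def unflatten_def vec_eq_iff)

lemma flatten_unflatten [simp]: "flatten (unflatten v) = v"
  by (simp add: flatten_def unflatten_def vec_eq_iff)

text \<open>\<open>linear\<close> is linearity over the reals; additivity together with
  \<open>csmult\<close> is linearity over the complex numbers, under which a complex matrix
  represents \<open>F\<close>.\<close>

lemma inj_iff_det_flat_matrix: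
  fixes F :: "'n::finite cmat \<Rightarrow> 'n cmat"
  assumes add: "\<And>X Y. F (X + Y) = F X + F Y" and smult: "\<And>c X. F (csmult c X) = csmult c (F X)"
  shows "inj F \<longleftrightarrow> det (flat_matrix F) \<noteq> 0"
proof -
  let ?F = "\<lambda>v. flatten (F (unflatten v))"
  have "Vector_Spaces.linear (*s) (*s) ?F"
  proof
    fix v w :: "complex ^ ('n \<times> 'n)" and c
    have "unflatten (v + w) = unflatten v + unflatten w"
      by (simp add: unflatten_def vec_eq_iff)
    then show "?F (v + w) = ?F v + ?F w"
      by (simp add: add) (simp add: flatten_def vec_eq_iff)
    have "unflatten (c *s v) = csmult c (unflatten v)"
      by (simp add: unflatten_def vec_eq_iff)
    then show "?F (c *s v) = c *s ?F v"
      by (simp add: smult) (simp add: flatten_def vec_eq_iff)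
  qed
  then have mult: "(*v) (flat_matrix F) = ?F"
    by (auto simp: flat_matrix_def matrix_works)
  have "inj F \<longleftrightarrow> inj ?F"
    by (smt (verit) flatten_unflatten inj_def unflatten_flatten)
  also have "\<dots> \<longleftrightarrow> (\<exists>B. B ** flat_matrix F = mat 1)"
    by (simp add: matrix_left_invertible_injective mult)
  also have "\<dots> \<longleftrightarrow> det (flat_matrix F) \<noteq> 0"
    by (metis invertible_def invertible_det_nz matrix_left_right_inverse)
  finally show ?thesis .
qed

lemma cpolyfun_det:
  assumes "\<And>i j. cpolyfun (\<lambda>x. A x $ i $ j)"
  shows "cpolyfun (\<lambda>x. det (A x :: complex ^ 'm ^ 'm::finite))"
  unfolding det_def by (intro cpolyfun_sum cpolyfun_mult cpolyfun_prod cpolyfun_const assms)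

text \<open>The columns are the images of the matrix units, so polynomial dependence for each fixed
  argument is enough.\<close>

lemma cpolyfun_det_flat_matrix:
  assumes "\<And>X. poly_matrix_fun (\<lambda>x. F x X)"
  shows "cpolyfun (\<lambda>x. det (flat_matrix (F x)))"
proof (rule cpolyfun_det)
  show "cpolyfun (\<lambda>x. flat_matrix (F x) $ i $ j)" for i j
    using assms[of "unflatten (axis j 1)"]
    by (simp add: flat_matrix_def matrix_def flatten_def poly_matrix_fun_iff)
qed

section \<open>Genericity\<close>

lemma adj_drift:
  assumes "hermitian H"
  shows "adj (drift H L M) = csmult \<i> H - csmult (1/2) (\<Sum>k<M. adj (L k) ** L k)"
  using assms by (simp add: drift_def adj_diff adj_csmult adj_sum adj_mult hermitian_def)

lemma gksl_drift:
  assumes "hermitian H"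
  shows "gksl (drift H L M) L M"
proof
  show "drift H L M + adj (drift H L M) + (\<Sum>k<M. adj (L k) ** L k) = 0"
    unfolding adj_drift[OF assms] by (simp add: drift_def vec_eq_iff)
qed

text \<open>The commutator and the anticommutator halves of the dissipators combine into
  \<open>K\<close>; hermiticity of \<open>H\<close> turns \<open>- \<i>\<close> into
  \<open>\<i>\<close> in its adjoint.\<close>

lemma lindblad_eq_G:
  assumes "hermitian H"
  shows "lindblad H L M = gksl.G (drift H L M) L M"
proof
  fix X
  interpret gksl "drift H L M" L M
    using assms by (rule gksl_drift)
  define S where "S = (\<Sum>k<M. adj (L k) ** L k)"
  have "(\<Sum>k<M. dissipator (L k) X) = (\<Sum>k<M. L k ** X ** adj (L k)) - csmult (1/2) (S ** X + X ** S)"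
    by (simp add: dissipator_def S_def sum_subtractf csmult_sum[symmetric] sum.distrib
        matrix_mult_sum_left matrix_mult_sum_right matrix_mul_assoc)
  then show "lindblad H L M X = G X"
    unfolding lindblad_def G_def adj_drift[OF assms]
    by (simp add: drift_def matrix_mult_diff_left matrix_mult_diff_right csmult_mult_left
        csmult_mult_right flip: S_def) (simp add: vec_eq_iff algebra_simps)
qed

theorem theoremB1:
  fixes P :: "complex ^ 'n ^ 'n"
    and H :: "real ^ 'N \<Rightarrow> complex ^ 'n ^ 'n"
    and L :: "nat \<Rightarrow> real ^ 'N \<Rightarrow> complex ^ 'n ^ 'n"
    and M :: nat
    and xbar :: "real ^ 'N"
  assumes "orth_proj P" and "P \<noteq> 0" and "P \<noteq> mat 1"
    and "\<forall>x. hermitian (H x)"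
    and "poly_matrix_fun H"
    and "\<forall>k<M. poly_matrix_fun (L k)"
    and "\<forall>x. invariant P (lindblad (H x) (\<lambda>k. L k x) M)"
    and "GAS P (lindblad (H xbar) (\<lambda>k. L k xbar) M)"
  shows "AE x in lebesgue. GAS P (lindblad (H x) (\<lambda>k. L k x) M)"
proof -
  define K where "K = (\<lambda>x. drift (H x) (\<lambda>k. L k x) M)"
  have G: "lindblad (H x) (\<lambda>k. L k x) M = gksl.G (K x) (\<lambda>k. L k x) M" for x
    using lindblad_eq_G assms(4) by (auto simp: K_def)
  have gksl: "gksl (K x) (\<lambda>k. L k x) M" for x
    unfolding K_def using assms(4) by (intro gksl_drift) simp
  have gksl_proj: "gksl_proj (K x) (\<lambda>k. L k x) M P" for x
    using gksl assms(1) by (simp add: gksl_proj_def gksl_proj_axioms_def)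
  \<comment> \<open>Invariance at every parameter makes all the operators triangular, so the
    injectivity criterion holds at each \<open>x\<close> and not just at
    \<open>xbar\<close>.\<close>
  have gksl_block: "gksl_block (K x) (\<lambda>k. L k x) M P" for x
  proof -
    interpret gksl_proj "K x" "\<lambda>k. L k x" M P
      by (rule gksl_proj)
    show ?thesis
      using invariant_block_structure assms(2,7) by unfold_locales (auto simp: G)
  qed
  define T where "T = (\<lambda>x. gksl_proj.T (K x) (\<lambda>k. L k x) M P)"
  have det: "inj (T x) \<longleftrightarrow> det (flat_matrix (T x)) \<noteq> 0" for x
    unfolding T_def
    by (intro inj_iff_det_flat_matrix gksl_proj.T_csmult[OF gksl_proj]
        linear_add[OF gksl_proj.linear_T[OF gksl_proj]])
  have "poly_matrix_fun K"
    unfolding K_def drift_def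
    by (intro poly_matrix_fun_intros poly_matrix_fun_sum assms) (use assms(6) in auto)
  then have "poly_matrix_fun (\<lambda>x. T x X)" for X
    unfolding T_def gksl_proj.T_def[OF gksl_proj] gksl.G_def[OF gksl]
    by (intro poly_matrix_fun_intros poly_matrix_fun_sum) (use assms(6) in auto)
  then have "cpolyfun (\<lambda>x. det (flat_matrix (T x)))"
    by (rule cpolyfun_det_flat_matrix)
  \<comment> \<open>The given stable parameter supplies the one point where the determinant is
    nonzero.\<close>
  moreover have "inj (T xbar)"
    unfolding T_def using assms(8) by (intro gksl_block.inj_if_GAS[OF gksl_block]) (simp add: G)
  ultimately have "negligible {x. det (flat_matrix (T x)) = 0}"
    by (intro negligible_cpolyfun_zeros[of _ xbar]) (simp_all add: det)
  moreover have "GAS P (lindblad (H x) (\<lambda>k. L k x) M)" if "det (flat_matrix (T x)) \<noteq> 0" for x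
    using gksl_block.GAS_if_inj[OF gksl_block, of x] assms(7) that det[of x]
    by (simp add: G T_def)
  ultimately show ?thesis
    unfolding eventually_ae_filter_negligible by blast
qed

end
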